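(* Consider the problem $p_\star=\min_{x\in\mathcal X}h(g_1(x),\dots,g_m(x))+u(x)$ with each $g_j$ being $L_j$-smooth, and constants $\Delta,C,\varepsilon,r>0$. Then the algorithm UFCM, run with the $(C,\Delta)$-stepsizes, finds an $(\varepsilon,r)$-optimal solution with gradient complexity $N_{\varepsilon,r}$ and proximal complexity $P_{\varepsilon,r}$ given by $$N_{\varepsilon,r}=\sqrt{\frac{(C/\Delta+2L^{\mathrm{ADA}}_{\varepsilon,r})D_x^2+\frac{2}{C\Delta}(D_\lambda^2+r^2)}{\varepsilon}},\qquad P_{\varepsilon,r}=\lceil N_{\varepsilon,r}\rceil+\lceil N_{\varepsilon,r}\rceil^2\Delta M,$$ where $M$ is an upper bound for $\|\nabla g(x)\|$ over all $x\in\mathcal X$ with $\|x-x^\star\|^2\le \frac{1}{2L^{\mathrm{ADA}}_{\varepsilon,r}}\left[(C/\Delta+2L^{\mathrm{ADA}}_{\varepsilon,r})\|x^0-x^\star\|^2+\frac{1}{C\Delta}\|\lambda^0-\lambda^\star\|^2\right]$.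
   Context: **Problem.** $\|\cdot\|$ is the Euclidean norm (spectral norm for matrices). $\mathcal X\subseteq\mathbb R^n$ is closed convex; $u:\mathcal X\to\mathbb R\cup\{+\infty\}$, $g_1,\dots,g_m:\mathcal X\to\mathbb R$ and $h:\mathbb R^m\to\mathbb R\cup\{+\infty\}$ are closed convex; $h$ is component-wise nondecreasing; each $g_j$ is locally Lipschitz and $L_j$-smooth ($\nabla g_j$ is $L_j$-Lipschitz). $g=(g_1,\dots,g_m)$, $\nabla g(x)\in\mathbb R^{m\times n}$ has rows $\nabla g_j(x)$. $f^*$ is the convex conjugate of $f$; $\Lambda=\mathrm{dom}(h^* )\subseteq\mathbb R^m_+$, $g^*(\nu)=(g_j^*(\nu_j))_j$, $V=\mathrm{dom}(g^* )=\prod_j\mathrm{dom}(g_j^* )\subseteq\mathbb R^{m\times n}$. The extended Lagrangian is $\mathcal L(x;\lambda,\nu)=\langle\lambda,\nu x-g^*(\nu)\rangle-h^*(\lambda)+u(x)$ on $\mathcal X\times\Lambda\times V$ (min in $x$, max in $(\lambda,\nu)$). It is assumed to have a saddle point; fix one, $z^\star=(x^\star;\lambda^\star,\nu^\star)$ with $\nu^\star=\nabla g(x^\star)$. $D_x,D_\lambda>0$ satisfy $D_x\ge\|x^0-x^\star\|$, $D_\lambda\ge\|\lambda^0-\lambda^\star\|$. **Aggregate smoothness.** $L^{\mathrm{ADA}}_{\varepsilon,r}=\sum_{j=1}^m(\lambda_j^\star+r)L_j$. **$(\varepsilon,r)$-optimality.** $x$ is $(\varepsilon,r)$-optimal if there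 exist $\hat g\in\mathbb R^m$ and $\hat\lambda\in\partial h(\hat g)$ with $h(\hat g)+\langle\hat\lambda,g(x)-\hat g\rangle+u(x)-p_\star\le\varepsilon$ and $r\|g(x)-\hat g\|\le\varepsilon$. **Algorithm UFCM.** Input $(x^0,\lambda^0)\in\mathcal X\times\Lambda$ and $T\ge1$. Initialize $x^{-1}=\underline x^0=y_0^{(1)}=x^0$, $\lambda_{-1}^{(1)}=\lambda_0^{(1)}=\lambda^0$, $\nu^0=\nabla g(x^0)$. For $t=1,\dots,T$: (i) $\tilde x^t=x^{t-1}+\theta_t(x^{t-1}-x^{t-2})$, $\underline x^t=(\tau_t\underline x^{t-1}+\tilde x^t)/(1+\tau_t)$, $\nu^t=\nabla g(\underline x^t)$; (ii) for $s=1,\dots,S_t$: let $\tilde h^{(t),s}=(\nu^t)^\top\lambda_0^{(t)}+\rho^{(t)}(\nu^{t-1})^\top(\lambda_0^{(t)}-\lambda_{-1}^{(t)})$ if $s=1$ and $\tilde h^{(t),s}=(\nu^t)^\top\lambda_{s-1}^{(t)}+(\nu^t)^\top(\lambda_{s-1}^{(t)}-\lambda_{s-2}^{(t)})$ otherwise; $y_s^{(t)}=\arg\min_{y\in\mathcal X}\langle\tilde h^{(t),s},y\rangle+u(y)+\frac{\eta_t}2\|y-x^{t-1}\|^2+\frac{\beta^{(t)}}2\|y-y_{s-1}^{(t)}\|^2$; $\lambda_s^{(t)}=\arg\max_{\lambda\in\Lambda}\langle\lambda,\nu^t(y_s^{(t)}-\underline x^t)+g(\underline x^t)\rangle-h^*(\lambda)-\frac{\gamma^{(t)}}2\|\lambda-\lambda_{s-1}^{(t)}\|^2$;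 (iii) $\lambda_0^{(t+1)}=\lambda_{S_t}^{(t)}$, $\lambda_{-1}^{(t+1)}=\lambda_{S_t-1}^{(t)}$, $y_0^{(t+1)}=y_{S_t}^{(t)}$, $x^t=\frac1{S_t}\sum_{s}y_s^{(t)}$, $\tilde\lambda^t=\frac1{S_t}\sum_s\lambda_s^{(t)}$. Output $(\bar x^T,\bar\lambda^T)=\sum_{t=1}^T\omega_t(x^t,\tilde\lambda^t)/\sum_{t=1}^T\omega_t$. **$(C,\Delta)$-stepsizes.** With $L=L^{\mathrm{ADA}}_{\varepsilon,r}$: $\tau_t=\frac{t-1}2$, $\eta_t=L/\tau_{t+1}$, $\theta_t=\tau_t/(\tau_{t-1}+1)$, $\omega_t=t$; $M_t=\|\nu^t\|$, $S_t=\lceil M_t\Delta t\rceil$ (assumed $\ge1$), $\tilde M_t=S_t/(\Delta t)$; $\rho^{(t)}=\tilde M_t/\tilde M_{t-1}$ ($\rho^{(1)}$ is irrelevant since $\lambda_0^{(1)}=\lambda_{-1}^{(1)}$), $\beta^{(t)}=C\tilde M_t$, $\gamma^{(t)}=\tilde M_t/C$. **Complexities.** Gradient complexity $N_{\varepsilon,r}$ means: for any $T\ge N_{\varepsilon,r}$, $\bar x^T$ is $(\varepsilon,r)$-optimal (each outer iteration evaluates one gradient of each $g_j$). Proximal complexity $P_{\varepsilon,r}$ means: at most $\lceil P_{\varepsilon,r}\rceil$ proximal evaluations of $u$ and $h$ (one of each per inner iteration) are performed in the first $\lceil N_{\varepsilon,r}\rceil$ outer iterations. *)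

theory Defs
  imports "HOL-Analysis.Analysis"
begin

section \<open>Convex analysis with extended values\<close>

text \<open>A function on a set \<open>S\<close> is represented by a total function; its values outside \<open>S\<close> are
  never used.\<close>

definition closed_convex_on :: "'a::euclidean_space set \<Rightarrow> ('a \<Rightarrow> ereal) \<Rightarrow> bool" where
  "closed_convex_on S f \<longleftrightarrow>
     closed {(x, c::real). x \<in> S \<and> f x \<le> ereal c} \<and>
     convex {(x, c::real). x \<in> S \<and> f x \<le> ereal c}"

definition proper_on :: "'a set \<Rightarrow> ('a \<Rightarrow> ereal) \<Rightarrow> bool" where
  "proper_on S f \<longleftrightarrow> (\<forall>x\<in>S. f x \<noteq> -\<infinity>) \<and> (\<exists>x\<in>S. f x \<noteq> \<infinity>)"

definition conjugate_on :: "'a::euclidean_space set \<Rightarrow> ('a \<Rightarrow> ereal) \<Rightarrow> 'a \<Rightarrow> ereal" where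
  "conjugate_on S f y = (SUP x\<in>S. ereal (y \<bullet> x) - f x)"

definition subdifferential :: "('a::euclidean_space \<Rightarrow> ereal) \<Rightarrow> 'a \<Rightarrow> 'a set" where
  "subdifferential f v = {l. \<forall>w. f v + ereal (l \<bullet> (w - v)) \<le> f w}"

definition spectral_norm :: "real^'n^'m \<Rightarrow> real" where
  "spectral_norm A = onorm ((*v) A)"


section \<open>The composite problem\<close>

definition smooth_on :: "(real^'n) set \<Rightarrow> real \<Rightarrow> (real^'n \<Rightarrow> real) \<Rightarrow> (real^'n \<Rightarrow> real^'n) \<Rightarrow> bool" where
  \<comment> \<open>\<open>df\<close> is a gradient of \<open>f\<close> on \<open>X\<close>, taken relative to \<open>X\<close> because \<open>f\<close> is only defined there.\<close>
  "smooth_on X K f df \<longleftrightarrow>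
     (\<forall>x\<in>X. (f has_derivative (\<lambda>d. df x \<bullet> d)) (at x within X)) \<and> K-lipschitz_on X df"

definition locally_lipschitz_on :: "(real^'n) set \<Rightarrow> (real^'n \<Rightarrow> real) \<Rightarrow> bool" where
  "locally_lipschitz_on X f \<longleftrightarrow> (\<forall>x\<in>X. \<exists>e>0. \<exists>K. K-lipschitz_on (cball x e \<inter> X) f)"

definition opt_value ::
    "(real^'n) set \<Rightarrow> (real^'n \<Rightarrow> ereal) \<Rightarrow> (real^'n \<Rightarrow> real^'m) \<Rightarrow> (real^'m \<Rightarrow> ereal) \<Rightarrow> ereal" where
  "opt_value X u g h = (INF x\<in>X. h (g x) + u x)"

definition Lambda_dom :: "(real^'m \<Rightarrow> ereal) \<Rightarrow> (real^'m) set" where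
  "Lambda_dom h = {lam. conjugate_on UNIV h lam < \<infinity>}"

definition V_dom :: "(real^'n) set \<Rightarrow> (real^'n \<Rightarrow> real^'m) \<Rightarrow> (real^'n^'m) set" where
  "V_dom X g = {nu. \<forall>j. conjugate_on X (\<lambda>x. ereal (g x $ j)) (nu $ j) < \<infinity>}"

text \<open>The conjugates are finite on \<open>V_dom X g\<close> (for nonempty \<open>X\<close>), the only place where \<open>g_conj\<close> is used.\<close>

definition g_conj :: "(real^'n) set \<Rightarrow> (real^'n \<Rightarrow> real^'m) \<Rightarrow> real^'n^'m \<Rightarrow> real^'m" where
  "g_conj X g nu = (\<chi> j. real_of_ereal (conjugate_on X (\<lambda>x. ereal (g x $ j)) (nu $ j)))"

definition lagrangian ::
    "(real^'n) set \<Rightarrow> (real^'n \<Rightarrow> ereal) \<Rightarrow> (real^'n \<Rightarrow> real^'m) \<Rightarrow> (real^'m \<Rightarrow> ereal) \<Rightarrow>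
     real^'n \<Rightarrow> real^'m \<Rightarrow> real^'n^'m \<Rightarrow> ereal" where
  "lagrangian X u g h x lam nu =
     ereal (lam \<bullet> (nu *v x - g_conj X g nu)) - conjugate_on UNIV h lam + u x"

definition saddle_point ::
    "(real^'n) set \<Rightarrow> (real^'n \<Rightarrow> ereal) \<Rightarrow> (real^'n \<Rightarrow> real^'m) \<Rightarrow> (real^'m \<Rightarrow> ereal) \<Rightarrow>
     real^'n \<Rightarrow> real^'m \<Rightarrow> real^'n^'m \<Rightarrow> bool" where
  "saddle_point X u g h xs ls ns \<longleftrightarrow>
     xs \<in> X \<and> ls \<in> Lambda_dom h \<and> ns \<in> V_dom X g \<and>
     (\<forall>lam\<in>Lambda_dom h. \<forall>nu\<in>V_dom X g.
        lagrangian X u g h xs lam nu \<le> lagrangian X u g h xs ls ns) \<and>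
     (\<forall>x\<in>X. lagrangian X u g h xs ls ns \<le> lagrangian X u g h x ls ns)"

definition eps_r_optimal ::
    "(real^'n) set \<Rightarrow> (real^'n \<Rightarrow> ereal) \<Rightarrow> (real^'n \<Rightarrow> real^'m) \<Rightarrow> (real^'m \<Rightarrow> ereal) \<Rightarrow>
     real \<Rightarrow> real \<Rightarrow> real^'n \<Rightarrow> bool" where
  "eps_r_optimal X u g h eps r x \<longleftrightarrow> x \<in> X \<and>
     (\<exists>gh. \<exists>lh\<in>subdifferential h gh.
        h gh + ereal (lh \<bullet> (g x - gh)) + u x - opt_value X u g h \<le> ereal eps \<and>
        r * norm (g x - gh) \<le> eps)"

definition L_ADA :: "('m::finite \<Rightarrow> real) \<Rightarrow> real^'m \<Rightarrow> real \<Rightarrow> real" where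
  "L_ADA Ls ls r = (\<Sum>j\<in>UNIV. (ls $ j + r) * Ls j)"


section \<open>The algorithm\<close>

text \<open>Iteration indices are integers, since both the outer index of \<open>x\<close> and the inner index of
  \<open>lam\<close> start at \<open>-1\<close>.\<close>

record stepsizes =
  tau :: "int \<Rightarrow> real"
  eta :: "int \<Rightarrow> real"
  theta :: "int \<Rightarrow> real"
  omega :: "int \<Rightarrow> real"
  n_inner :: "int \<Rightarrow> int"   \<comment> \<open>\<open>S\<^sub>t\<close>\<close>
  rho :: "int \<Rightarrow> real"
  beta :: "int \<Rightarrow> real"
  gamma :: "int \<Rightarrow> real"

text \<open>\<open>ufcm_run \<dots> T x xt xu nu y lam lt xbar lbar\<close>: the sequences are those generated by the first \<open>T\<close>
  outer iterations, where \<open>xt t\<close>, \<open>xu t\<close>, \<open>y t s\<close>, \<open>lam t s\<close>, \<open>lt t\<close> stand for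
  \<open>x\<close>-tilde at \<open>t\<close>, \<open>x\<close>-underlined at \<open>t\<close>, the inner iterates \<open>s\<close> of phase \<open>t\<close>, and
  \<open>\<lambda>\<close>-tilde at \<open>t\<close>, and \<open>(xbar, lbar)\<close> is the output. The inner updates are equations for the
  total operators \<open>arg_min\<close> and \<open>arg_max\<close>, so such sequences exist whether or not the
  subproblems are known to be solvable.\<close>

definition extrapolation ::
    "stepsizes \<Rightarrow> (int \<Rightarrow> real^'n^'m) \<Rightarrow> (int \<Rightarrow> int \<Rightarrow> real^'m) \<Rightarrow> int \<Rightarrow> int \<Rightarrow> real^'n" where
  "extrapolation st nu lam t s =
     (if s = 1
      then transpose (nu t) *v lam t 0
           + rho st t *\<^sub>R (transpose (nu (t - 1)) *v (lam t 0 - lam t (-1)))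
      else transpose (nu t) *v lam t (s - 1)
           + transpose (nu t) *v (lam t (s - 1) - lam t (s - 2)))"

definition ufcm_run ::
    "(real^'n) set \<Rightarrow> (real^'n \<Rightarrow> ereal) \<Rightarrow> (real^'n \<Rightarrow> real^'m) \<Rightarrow> (real^'n \<Rightarrow> real^'n^'m) \<Rightarrow>
     (real^'m \<Rightarrow> ereal) \<Rightarrow> stepsizes \<Rightarrow> real^'n \<Rightarrow> real^'m \<Rightarrow> int \<Rightarrow>
     (int \<Rightarrow> real^'n) \<Rightarrow> (int \<Rightarrow> real^'n) \<Rightarrow> (int \<Rightarrow> real^'n) \<Rightarrow> (int \<Rightarrow> real^'n^'m) \<Rightarrow>
     (int \<Rightarrow> int \<Rightarrow> real^'n) \<Rightarrow> (int \<Rightarrow> int \<Rightarrow> real^'m) \<Rightarrow> (int \<Rightarrow> real^'m) \<Rightarrow>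
     real^'n \<Rightarrow> real^'m \<Rightarrow> bool" where
  "ufcm_run X u g G h st x0 l0 T x xt xu nu y lam lt xbar lbar \<longleftrightarrow>
     x (-1) = x0 \<and> x 0 = x0 \<and> xu 0 = x0 \<and> y 1 0 = x0 \<and>
     lam 1 (-1) = l0 \<and> lam 1 0 = l0 \<and> nu 0 = G x0 \<and>
     (\<forall>t\<in>{1..T}.
        xt t = x (t - 1) + theta st t *\<^sub>R (x (t - 1) - x (t - 2)) \<and>
        xu t = (1 / (1 + tau st t)) *\<^sub>R (tau st t *\<^sub>R xu (t - 1) + xt t) \<and>
        nu t = G (xu t) \<and>
        (\<forall>s\<in>{1..n_inner st t}.
           y t s = arg_min
             (\<lambda>v. ereal (extrapolation st nu lam t s \<bullet> v) + u v
                  + ereal (eta st t / 2 * (norm (v - x (t - 1)))\<^sup>2)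
                  + ereal (beta st t / 2 * (norm (v - y t (s - 1)))\<^sup>2))
             (\<lambda>v. v \<in> X) \<and>
           lam t s = arg_max
             (\<lambda>l. ereal (l \<bullet> (nu t *v (y t s - xu t) + g (xu t))) - conjugate_on UNIV h l
                  - ereal (gamma st t / 2 * (norm (l - lam t (s - 1)))\<^sup>2))
             (\<lambda>l. l \<in> Lambda_dom h)) \<and>
        lam (t + 1) 0 = lam t (n_inner st t) \<and>
        lam (t + 1) (-1) = lam t (n_inner st t - 1) \<and>
        y (t + 1) 0 = y t (n_inner st t) \<and>
        x t = (1 / of_int (n_inner st t)) *\<^sub>R (\<Sum>s=1..n_inner st t. y t s) \<and>
        lt t = (1 / of_int (n_inner st t)) *\<^sub>R (\<Sum>s=1..n_inner st t. lam t s)) \<and>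
     xbar = (1 / (\<Sum>t=1..T. omega st t)) *\<^sub>R (\<Sum>t=1..T. omega st t *\<^sub>R x t) \<and>
     lbar = (1 / (\<Sum>t=1..T. omega st t)) *\<^sub>R (\<Sum>t=1..T. omega st t *\<^sub>R lt t)"


section \<open>Stepsizes and complexities\<close>

definition CD_inner :: "real \<Rightarrow> (int \<Rightarrow> real^'n^'m) \<Rightarrow> int \<Rightarrow> int" where
  "CD_inner \<Delta> nu t = \<lceil>spectral_norm (nu t) * \<Delta> * of_int t\<rceil>"

definition CD_Mt :: "real \<Rightarrow> (int \<Rightarrow> real^'n^'m) \<Rightarrow> int \<Rightarrow> real" where
  "CD_Mt \<Delta> nu t = of_int (CD_inner \<Delta> nu t) / (\<Delta> * of_int t)"

text \<open>The number of inner iterations and the inner stepsizes are adaptive: at \<open>t\<close> they depend on the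
  gradients \<open>nu t\<close> and \<open>nu (t - 1)\<close> only. The value \<open>rho 1\<close> is \<open>0\<close> by division by zero; it multiplies
  \<open>lam 1 0 - lam 1 (-1) = 0\<close>.\<close>

definition CD_stepsizes :: "real \<Rightarrow> real \<Rightarrow> real \<Rightarrow> (int \<Rightarrow> real^'n^'m) \<Rightarrow> stepsizes" where
  "CD_stepsizes L C \<Delta> nu =
     (let \<tau> = (\<lambda>t::int. (of_int t - 1) / 2 :: real) in
      \<lparr> tau = \<tau>,
        eta = (\<lambda>t. L / \<tau> (t + 1)),
        theta = (\<lambda>t. \<tau> t / (\<tau> (t - 1) + 1)),
        omega = of_int,
        n_inner = CD_inner \<Delta> nu,
        rho = (\<lambda>t. CD_Mt \<Delta> nu t / CD_Mt \<Delta> nu (t - 1)),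
        beta = (\<lambda>t. C * CD_Mt \<Delta> nu t),
        gamma = (\<lambda>t. CD_Mt \<Delta> nu t / C) \<rparr>)"

definition N_grad :: "real \<Rightarrow> real \<Rightarrow> real \<Rightarrow> real \<Rightarrow> real \<Rightarrow> real \<Rightarrow> real \<Rightarrow> real" where
  "N_grad L C \<Delta> Dx Dl eps r =
     sqrt (((C / \<Delta> + 2 * L) * Dx\<^sup>2 + 2 / (C * \<Delta>) * (Dl\<^sup>2 + r\<^sup>2)) / eps)"

definition P_prox :: "real \<Rightarrow> real \<Rightarrow> real \<Rightarrow> real" where
  "P_prox N \<Delta> M = of_int \<lceil>N\<rceil> + (of_int \<lceil>N\<rceil>)\<^sup>2 * \<Delta> * M"

end

theory Submission
  imports Defs
begin

text \<open>The method nests a primal-dual loop inside an accelerated gradient loop, and the proof adds up the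
potential argument of each.

The saddle point enters only through two inequalities for the partially maximized Lagrangian
\<open>\<langle>\<lambda>, g v\<rangle> - h\<^sup>* \<lambda> + u v\<close>: at \<open>v = x\<^sup>*\<close> it is at most the saddle value for every \<open>\<lambda>\<close>
(\<open>saddle_dual\<close>), and at \<open>\<lambda> = \<lambda>\<^sup>*\<close> it is at least the saddle value for every \<open>v\<close> (\<open>saddle_primal\<close>).
The matrix variable \<open>\<nu>\<close> disappears because the conjugate of each \<open>g\<^sub>j\<close> at a gradient is known
explicitly, which turns \<open>\<nu> x - g\<^sup>* \<nu>\<close> into the linearization of \<open>g\<close> at the point of that gradient.

Inner loop. Both updates minimize a convex function plus a quadratic, so each satisfies a three-point
inequality (\<open>prox_three_point\<close>). Adding the two, the bilinear coupling term telescopes up to an error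
caused by the extrapolation, and this error is absorbed by the proximal terms because
\<open>\<beta> \<gamma>\<close> is the square of an upper bound on the norm of the coupling matrix (\<open>primal_dual_step\<close>). The
linearized gap of an inner iterate is thus bounded by a decrease of a potential. Weighting phase \<open>t\<close>
by \<open>t / S\<^sub>t\<close> makes the coefficients of the squared distances the same constants in every phase, and
\<open>\<rho>\<close> is exactly the factor that makes the final potential of a phase the initial one of the next
(\<open>phase_potential_start\<close>). Hence the potentials telescope across the phases as well (\<open>outer_step\<close>).

Outer loop. The linearization points satisfy
\<open>xu t = (t - 1) / (t + 1) z (t - 1) + 2 / (t + 1) x (t - 1)\<close>, where \<open>z t\<close> is the average of \<open>x 1, \<dots>, x t\<close>
with weights \<open>1, \<dots>, t\<close> (\<open>linearization_point_ergodic\<close>). This is Nesterov's scheme for the convex function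
\<open>\<langle>\<lambda>, g v\<rangle>\<close>, whose gradient has Lipschitz constant at most \<open>L\<close> as long as \<open>\<lambda>\<close> lies within \<open>r\<close> of
\<open>\<lambda>\<^sup>*\<close>. The usual step (\<open>accelerated_step\<close>) replaces linearized gaps by the gap at the average, at the cost of
\<open>L\<close> times the squared outer steps, which the \<open>\<eta>\<close>-terms provide. The result is
\<open>ergodic_gap_bound\<close>: at every \<open>\<lambda>\<close> within \<open>r\<close> of \<open>\<lambda>\<^sup>*\<close>, the gap of the average is of order \<open>1 / t\<^sup>2\<close>.

From gap to optimality. A minimizer \<open>w\<close> of the exact penalty function
\<open>h w - \<langle>\<lambda>\<^sup>*, w\<rangle> + r \<parallel>g v - w\<parallel>\<close> and a subgradient of \<open>h\<close> at \<open>w\<close>, obtained by separating an epigraph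
from a hypograph, are the pair required by \<open>(\<epsilon>, r)\<close>-optimality: the subgradient lies within \<open>r\<close> of
\<open>\<lambda>\<^sup>*\<close>, so the gap bound applies to it (\<open>exact_penalty_subgradient\<close>, \<open>eps_r_optimal_output\<close>).

Number of proximal steps. At \<open>\<lambda> = \<lambda>\<^sup>*\<close> the gap is nonnegative, so the same bound confines the outer iterates,
and with them the linearization points, to the ball on which \<open>M\<close> bounds the gradient. Summing
\<open>S\<^sub>t \<le> 1 + \<Delta> M t\<close> gives the count.\<close>

section \<open>Closed convex functions with extended values\<close>

text \<open>The arguments where a proper extended-valued function may be treated as real-valued.\<close>

definition effective_domain :: "'a set \<Rightarrow> ('a \<Rightarrow> ereal) \<Rightarrow> 'a set" where
  "effective_domain S f = {v \<in> S. f v < \<infinity>}"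

lemma ereal_real_effective_domain:
  assumes "proper_on S f" "v \<in> effective_domain S f"
  shows "f v = ereal (real_of_ereal (f v))"
  using assms by (cases "f v") (auto simp: effective_domain_def proper_on_def)

text \<open>A point strictly below the graph can be separated from the closed convex epigraph; the
separating hyperplane is not vertical because it separates the two points over the same argument.\<close>

lemma closed_convex_on_affine_minorant:
  assumes "closed_convex_on S f" "proper_on S f"
  obtains p \<alpha> where "\<And>v. v \<in> S \<Longrightarrow> ereal (p \<bullet> v + \<alpha>) \<le> f v"
proof -
  let ?E = "{(x, c::real). x \<in> S \<and> f x \<le> ereal c}"
  obtain a where a: "a \<in> S" "f a \<noteq> \<infinity>" "f a \<noteq> -\<infinity>"
    using assms(2) by (auto simp: proper_on_def)
  then obtain c where c: "f a = ereal c" by (cases "f a") auto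
  have "(a, c - 1) \<notin> ?E" using c by simp
  moreover have "closed ?E" "convex ?E"
    using assms(1) by (simp_all add: closed_convex_on_def)
  ultimately obtain n b where sep: "n \<bullet> (a, c - 1) < b" "\<forall>z\<in>?E. b < n \<bullet> z"
    using separating_hyperplane_closed_point[of ?E "(a, c - 1)"] by blast
  obtain p q where n: "n = (p, q)" by (cases n)
  have "(a, c) \<in> ?E" using a c by simp
  then have "b < p \<bullet> a + q * c" using sep(2) n by fastforce
  moreover have "p \<bullet> a + q * (c - 1) < b" using sep(1) n by simp
  ultimately have q: "q > 0" by (simp add: algebra_simps)
  have "ereal (((-1 / q) *\<^sub>R p) \<bullet> v + b / q) \<le> f v" if v: "v \<in> S" for v
  proof (cases "f v")
    case (real d)
    then have "(v, d) \<in> ?E" using v by simp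
    then have "b < p \<bullet> v + q * d" using sep(2) n by fastforce
    then show ?thesis using q real by (simp add: field_simps)
  qed (use assms(2) v in \<open>auto simp: proper_on_def\<close>)
  then show thesis by (rule that)
qed

text \<open>Minimizing over the epigraph replaces the lower semicontinuous function \<open>f\<close> by the continuous
last coordinate. The sublevel set there is compact: coercivity bounds the argument, and the
minorant \<open>m\<close> then bounds the height from below. Having \<open>m\<close> as a parameter lets the two applications,
a quadratic perturbation and a norm penalty, each supply the minorant that makes coercivity easy.\<close>

lemma ex_minimizer_coercive:
  fixes f :: "'a::euclidean_space \<Rightarrow> ereal"
  assumes f: "closed_convex_on S f" "proper_on S f"
    and minorant: "\<And>v. v \<in> S \<Longrightarrow> ereal (m v) \<le> f v"
    and cont: "continuous_on UNIV m" "continuous_on UNIV Q"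
    and coercive: "\<And>K. bounded {v. m v + Q v \<le> K}"
  obtains v where "v \<in> S" "f v \<noteq> \<infinity>"
    "\<And>w. w \<in> S \<Longrightarrow> f v + ereal (Q v) \<le> f w + ereal (Q w)"
proof -
  let ?E = "{(x, c::real). x \<in> S \<and> f x \<le> ereal c}"
  define \<psi> where "\<psi> = (\<lambda>z::'a \<times> real. snd z + Q (fst z))"
  obtain a where a: "a \<in> S" "f a \<noteq> \<infinity>" "f a \<noteq> -\<infinity>"
    using f(2) by (auto simp: proper_on_def)
  then obtain c where c: "f a = ereal c" by (cases "f a") auto
  define K where "K = \<psi> (a, c)"
  define B where "B = {v. m v + Q v \<le> K}"
  have clB: "compact (closure B)"
    using coercive by (simp add: B_def compact_closure)
  have cm: "continuous_on (closure B) m" and cQ: "continuous_on (closure B) (\<lambda>v. K - Q v)"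
    using cont by (auto intro!: continuous_on_diff continuous_on_const intro: continuous_on_subset)
  have \<psi>c: "continuous_on A \<psi>" for A unfolding \<psi>_def
    by (intro continuous_intros continuous_on_compose2[OF cont(2)]) auto
  let ?F = "?E \<inter> {z. \<psi> z \<le> K}"
  have in_B: "fst z \<in> B \<and> m (fst z) \<le> snd z \<and> snd z \<le> K - Q (fst z)" if "z \<in> ?F" for z
  proof -
    have "ereal (m (fst z)) \<le> ereal (snd z)"
      using that minorant[of "fst z"] order_trans[of "ereal (m (fst z))" "f (fst z)" "ereal (snd z)"] by auto
    then show ?thesis using that by (auto simp: B_def \<psi>_def)
  qed
  have "bounded ?F"
  proof -
    obtain b1 where b1: "\<And>v. v \<in> closure B \<Longrightarrow> norm v \<le> b1"
      using compact_imp_bounded[OF clB] unfolding bounded_iff by metis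
    obtain b2 where b2: "\<And>v. v \<in> closure B \<Longrightarrow> \<bar>m v\<bar> \<le> b2"
      using compact_imp_bounded[OF compact_continuous_image[OF cm clB]] unfolding bounded_iff
      by (metis imageI real_norm_def)
    obtain b3 where b3: "\<And>v. v \<in> closure B \<Longrightarrow> \<bar>K - Q v\<bar> \<le> b3"
      using compact_imp_bounded[OF compact_continuous_image[OF cQ clB]] unfolding bounded_iff
      by (metis imageI real_norm_def)
    have "norm z \<le> b1 + (b2 + b3)" if "z \<in> ?F" for z
    proof -
      have z: "fst z \<in> closure B" "m (fst z) \<le> snd z" "snd z \<le> K - Q (fst z)"
        using in_B[OF that] closure_subset by auto
      have "norm z \<le> norm (fst z) + norm (snd z)"
        by (metis norm_Pair_le prod.collapse)
      moreover have "norm (snd z) \<le> b2 + b3"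
        using z b2[of "fst z"] b3[of "fst z"] by auto
      ultimately show ?thesis using b1[of "fst z"] z by linarith
    qed
    then show ?thesis by (intro boundedI)
  qed
  moreover have "closed ?F"
  proof (intro closed_Int)
    show "closed ?E" using f(1) by (simp add: closed_convex_on_def)
    show "closed {z. \<psi> z \<le> K}" using \<psi>c by (intro closed_Collect_le) auto
  qed
  ultimately have "compact ?F" by (simp add: compact_eq_bounded_closed)
  moreover have ac: "(a, c) \<in> ?F" using a c by (simp add: K_def)
  ultimately obtain z where z: "z \<in> ?F" "\<And>w. w \<in> ?F \<Longrightarrow> \<psi> z \<le> \<psi> w"
    using continuous_attains_inf[of ?F \<psi>] \<psi>c by blast
  obtain v d where vd: "z = (v, d)" by (cases z)
  have v: "v \<in> S" "f v \<le> ereal d" using z(1) vd by auto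
  have least: "f v + ereal (Q v) \<le> f w + ereal (Q w)" if w: "w \<in> S" for w
  proof (cases "f w")
    case (real e)
    have "d + Q v \<le> e + Q w"
    proof (cases "\<psi> (w, e) \<le> K")
      case True
      then show ?thesis using z(2)[of "(w, e)"] w real vd by (simp add: \<psi>_def)
    next
      case False
      then show ?thesis using z(1) vd by (simp add: \<psi>_def)
    qed
    then have "ereal d + ereal (Q v) \<le> f w + ereal (Q w)" using real by simp
    then show ?thesis using v(2) add_right_mono order_trans by blast
  qed (use f(2) w in \<open>auto simp: proper_on_def\<close>)
  show thesis by (rule that[OF v(1) _ least]) (use v(2) in auto)
qed

lemma closed_convex_on_imp_convex_on:
  assumes "closed_convex_on S f" "proper_on S f"
  shows "convex_on (effective_domain S f) (\<lambda>v. real_of_ereal (f v))"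
proof -
  have *: "a *\<^sub>R v + b *\<^sub>R w \<in> S \<and> f (a *\<^sub>R v + b *\<^sub>R w)
      \<le> ereal (a * real_of_ereal (f v) + b * real_of_ereal (f w))"
    if vw: "v \<in> effective_domain S f" "w \<in> effective_domain S f"
      and ab: "a \<ge> 0" "b \<ge> 0" "a + b = 1" for v w and a b :: real
  proof -
    let ?E = "{(x, c::real). x \<in> S \<and> f x \<le> ereal c}"
    have mem: "(z, real_of_ereal (f z)) \<in> ?E" if "z \<in> effective_domain S f" for z
      using that ereal_real_effective_domain[OF assms(2) that]
      by (auto simp: effective_domain_def)
    have "a *\<^sub>R (v, real_of_ereal (f v)) + b *\<^sub>R (w, real_of_ereal (f w)) \<in> ?E"
      by (rule convexD) (use assms(1) mem vw ab in \<open>auto simp: closed_convex_on_def\<close>)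
    then show ?thesis by simp
  qed
  have dom: "a *\<^sub>R v + b *\<^sub>R w \<in> effective_domain S f"
    if "v \<in> effective_domain S f" "w \<in> effective_domain S f" "a \<ge> 0" "b \<ge> 0" "a + b = 1" for v w a b
    using *[OF that] by (auto simp: effective_domain_def intro: le_less_trans)
  show ?thesis
    unfolding convex_on_def
  proof (intro conjI ballI allI impI)
    show "convex (effective_domain S f)" using dom by (auto simp: convex_def)
    fix v w a b
    assume vw: "v \<in> effective_domain S f" "w \<in> effective_domain S f"
      and ab: "(0::real) \<le> a" "0 \<le> b" "a + b = 1"
    have "ereal (real_of_ereal (f (a *\<^sub>R v + b *\<^sub>R w)))
        \<le> ereal (a * real_of_ereal (f v) + b * real_of_ereal (f w))"
      using *[OF vw ab] ereal_real_effective_domain[OF assms(2) dom[OF vw ab]] by simp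
    then show "real_of_ereal (f (a *\<^sub>R v + b *\<^sub>R w))
        \<le> a * real_of_ereal (f v) + b * real_of_ereal (f w)" by simp
  qed
qed

section \<open>Proximal steps\<close>

text \<open>The exact defect of convexity of the squared distance; it is the source of all strong convexity below.\<close>

lemma norm_sq_convex_combination:
  fixes v w p :: "'a::real_inner"
  assumes "a + b = 1"
  shows "(norm (a *\<^sub>R v + b *\<^sub>R w - p))\<^sup>2
    = a * (norm (v - p))\<^sup>2 + b * (norm (w - p))\<^sup>2 - a * b * (norm (v - w))\<^sup>2"
proof -
  have b: "b = 1 - a" using assms by simp
  show ?thesis unfolding b power2_norm_eq_inner
    by (simp add: inner_simps inner_commute algebra_simps)
qed

text \<open>The smooth part of the subproblems: a linear term and two proximal terms. The primal update
uses both of the latter, the dual update (with \<open>a = 0\<close>) only one.\<close>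

definition prox_model :: "'a::euclidean_space \<Rightarrow> real \<Rightarrow> 'a \<Rightarrow> real \<Rightarrow> 'a \<Rightarrow> 'a \<Rightarrow> real" where
  "prox_model c a p b q v = c \<bullet> v + a / 2 * (norm (v - p))\<^sup>2 + b / 2 * (norm (v - q))\<^sup>2"

text \<open>The subproblems are solvable: an affine minorant of \<open>f\<close> cannot compete with the quadratic
growth. This is what gives meaning to the total operators in the definition of a run.\<close>

lemma prox_ex_minimizer:
  fixes f :: "'a::euclidean_space \<Rightarrow> ereal"
  assumes f: "closed_convex_on S f" "proper_on S f" and a: "a \<ge> 0" and b: "b > 0"
  obtains v where "v \<in> S"
    "\<And>w. w \<in> S \<Longrightarrow> f v + ereal (prox_model c a p b q v) \<le> f w + ereal (prox_model c a p b q w)"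
proof -
  obtain d \<alpha> where m: "\<And>v. v \<in> S \<Longrightarrow> ereal (d \<bullet> v + \<alpha>) \<le> f v"
    using closed_convex_on_affine_minorant[OF f] by blast
  \<comment> \<open>The term with coefficient \<open>a\<close> may vanish, so coercivity comes from \<open>b\<close> alone.\<close>
  have "bounded {v. (d \<bullet> v + \<alpha>) + prox_model c a p b q v \<le> K}" for K
  proof -
    define k where "k = norm (d + c)"
    define J where "J = \<bar>K - \<alpha> - (d + c) \<bullet> q\<bar>"
    have "norm (v - q) \<le> 2 * k / b + 2 * J / b + 1"
      if v: "(d \<bullet> v + \<alpha>) + prox_model c a p b q v \<le> K" for v
    proof -
      define x where "x = norm (v - q)"
      have "0 \<le> a / 2 * (norm (v - p))\<^sup>2" using a by simp
      then have "(d + c) \<bullet> v + \<alpha> + b / 2 * x\<^sup>2 \<le> K"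
        using v unfolding prox_model_def x_def by (simp add: inner_simps)
      moreover have "(d + c) \<bullet> v = (d + c) \<bullet> (v - q) + (d + c) \<bullet> q" by (simp add: inner_simps)
      moreover have "\<bar>(d + c) \<bullet> (v - q)\<bar> \<le> k * x"
        unfolding k_def x_def by (rule Cauchy_Schwarz_ineq2)
      ultimately have q1: "b / 2 * x\<^sup>2 \<le> k * x + J" unfolding J_def by linarith
      have pos: "k \<ge> 0" "J \<ge> 0" "x \<ge> 0" by (simp_all add: k_def J_def x_def)
      show ?thesis
      proof (rule ccontr)
        assume "\<not> ?thesis"
        then have big: "x > 2 * k / b + 2 * J / b + 1" by (simp add: x_def)
        have "2 * k / b \<ge> 0" "2 * J / b \<ge> 0" using pos b by simp_all
        then have x1: "x \<ge> 1" using big by linarith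
        have "b * x > 2 * k + 2 * J + b" using big b by (simp add: field_simps)
        then have "b * x * x > (2 * k + 2 * J + b) * x" using x1 by simp
        moreover have "(2 * k + 2 * J + b) * x \<ge> 2 * k * x + 2 * J"
        proof -
          have "J * 1 \<le> J * x" using x1 pos by (intro mult_left_mono)
          moreover have "0 \<le> b * x" using x1 b by simp
          ultimately show ?thesis by (simp add: algebra_simps)
        qed
        ultimately show False using q1 by (simp add: power2_eq_square)
      qed
    qed
    then have "{v. (d \<bullet> v + \<alpha>) + prox_model c a p b q v \<le> K}
        \<subseteq> cball q (2 * k / b + 2 * J / b + 1)"
      by (auto simp: dist_norm norm_minus_commute)
    then show ?thesis using bounded_cball bounded_subset by blast
  qed
  moreover have "continuous_on UNIV (prox_model c a p b q)"
    unfolding prox_model_def by (intro continuous_intros)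
  moreover have "continuous_on UNIV (\<lambda>v. d \<bullet> v + \<alpha>)" by (intro continuous_intros)
  ultimately show thesis
    using ex_minimizer_coercive[OF f m] that by blast
qed

text \<open>Since the model is \<open>a + b\<close> strongly convex, comparing the minimizer \<open>v\<close> with the point
at parameter \<open>s\<close> on the segment to \<open>w\<close> gives the claim with \<open>(1 - s) (a + b) / 2\<close>; then let \<open>s\<close> tend to 0.\<close>

lemma prox_three_point:
  fixes f :: "'a::euclidean_space \<Rightarrow> ereal"
  assumes f: "closed_convex_on S f" "proper_on S f" and v: "v \<in> S"
    and least: "\<And>w. w \<in> S \<Longrightarrow> f v + ereal (prox_model c a p b q v) \<le> f w + ereal (prox_model c a p b q w)"
  shows "v \<in> effective_domain S f"
    and "w \<in> effective_domain S f \<Longrightarrow>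
      real_of_ereal (f v) + prox_model c a p b q v + (a + b) / 2 * (norm (w - v))\<^sup>2
        \<le> real_of_ereal (f w) + prox_model c a p b q w"
proof -
  let ?D = "effective_domain S f" and ?F = "\<lambda>v. real_of_ereal (f v)" and ?Q = "prox_model c a p b q"
  obtain x where "x \<in> S" "f x \<noteq> \<infinity>" using f(2) by (auto simp: proper_on_def)
  then show vD: "v \<in> ?D"
    using least[of x] v by (cases "f x") (auto simp: effective_domain_def)
  have leastD: "?F v + ?Q v \<le> ?F z + ?Q z" if "z \<in> ?D" for z
  proof -
    have "ereal (?F v) + ereal (?Q v) \<le> ereal (?F z) + ereal (?Q z)"
      using least[of z] that ereal_real_effective_domain[OF f(2) vD]
        ereal_real_effective_domain[OF f(2) that] by (simp add: effective_domain_def)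
    then show ?thesis by simp
  qed
  assume w: "w \<in> ?D"
  define e where "e = (a + b) / 2 * (norm (w - v))\<^sup>2"
  have bound: "?F v + ?Q v + (1 - s) * e \<le> ?F w + ?Q w" if s: "0 < s" "s < 1" for s :: real
  proof -
    let ?z = "(1 - s) *\<^sub>R v + s *\<^sub>R w"
    have cvx: "convex_on ?D ?F" by (rule closed_convex_on_imp_convex_on[OF f])
    have "?z \<in> ?D" using convexD[OF convex_on_imp_convex[OF cvx] vD w, of "1 - s" s] s by simp
    moreover have "?F ?z \<le> (1 - s) * ?F v + s * ?F w"
      using convex_onD[OF cvx, of s v w] s vD w by simp
    moreover have "?Q ?z = (1 - s) * ?Q v + s * ?Q w - (1 - s) * s * e"
    proof -
      have n: "(norm (?z - y))\<^sup>2 = (1 - s) * (norm (v - y))\<^sup>2 + s * (norm (w - y))\<^sup>2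
          - (1 - s) * s * (norm (w - v))\<^sup>2" for y
        using norm_sq_convex_combination[of "1 - s" s v w y] by (simp add: norm_minus_commute)
      show ?thesis
        unfolding prox_model_def e_def n by (simp add: inner_simps algebra_simps add_divide_distrib diff_divide_distrib)
    qed
    ultimately have "?F v + ?Q v \<le> (1 - s) * ?F v + s * ?F w + ((1 - s) * ?Q v + s * ?Q w - (1 - s) * s * e)"
      using leastD[of ?z] by linarith
    then have "s * (?F v + ?Q v + (1 - s) * e) \<le> s * (?F w + ?Q w)"
      by (simp add: algebra_simps)
    then show ?thesis using s by simp
  qed
  have "?F v + ?Q v + (1 - 0) * e \<le> ?F w + ?Q w"
  proof (rule tendsto_upperbound)
    show "((\<lambda>s. ?F v + ?Q v + (1 - s) * e) \<longlongrightarrow> ?F v + ?Q v + (1 - 0) * e) (at_right 0)"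
      by (intro tendsto_intros)
    show "\<forall>\<^sub>F s in at_right 0. ?F v + ?Q v + (1 - s) * e \<le> ?F w + ?Q w"
      using eventually_at_right_less[of 0] eventually_at_right_real[of 0 1]
      by (auto intro: eventually_mono bound)
  qed simp
  then show "?F v + ?Q v + (a + b) / 2 * (norm (w - v))\<^sup>2 \<le> ?F w + ?Q w"
    by (simp add: e_def)
qed

section \<open>The conjugate of the outer function\<close>

lemma conjugate_on_le_iff:
  "conjugate_on S f l \<le> b \<longleftrightarrow> (\<forall>v\<in>S. ereal (l \<bullet> v) - f v \<le> b)"
  by (simp add: conjugate_on_def SUP_le_iff)

lemma fenchel_young: "v \<in> S \<Longrightarrow> ereal (l \<bullet> v) - f v \<le> conjugate_on S f l"
  unfolding conjugate_on_def by (rule SUP_upper)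

lemma conjugate_le_real_iff:
  assumes "proper_on UNIV h"
  shows "conjugate_on UNIV h l \<le> ereal c \<longleftrightarrow> (\<forall>v\<in>effective_domain UNIV h. l \<bullet> v - real_of_ereal (h v) \<le> c)"
proof -
  have "ereal (l \<bullet> v) - h v \<le> ereal c \<longleftrightarrow>
      (v \<in> effective_domain UNIV h \<longrightarrow> l \<bullet> v - real_of_ereal (h v) \<le> c)" for v
    using assms by (cases "h v") (auto simp: effective_domain_def proper_on_def)
  then show ?thesis by (auto simp: conjugate_on_le_iff)
qed

text \<open>The epigraph of a conjugate is an intersection of closed half-spaces, one for each point at
which \<open>h\<close> is finite.\<close>

lemma closed_convex_conjugate:
  assumes "proper_on UNIV h"
  shows "closed_convex_on (Lambda_dom h) (conjugate_on UNIV h)"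
proof -
  have eq: "{(l, c::real). l \<in> Lambda_dom h \<and> conjugate_on UNIV h l \<le> ereal c}
      = (\<Inter>v\<in>effective_domain UNIV h. {z. (v, -1) \<bullet> z \<le> real_of_ereal (h v)})"
  proof -
    have "l \<in> Lambda_dom h \<and> conjugate_on UNIV h l \<le> ereal c
        \<longleftrightarrow> conjugate_on UNIV h l \<le> ereal c" for l c
      by (auto simp: Lambda_dom_def intro: le_less_trans)
    then show ?thesis
      unfolding conjugate_le_real_iff[OF assms]
      by (fastforce simp: inner_commute algebra_simps)
  qed
  show ?thesis
    unfolding closed_convex_on_def eq
    by (auto intro!: closed_INT closed_halfspace_le convex_INT convex_halfspace_le)
qed

lemma conjugate_not_MInf:
  assumes "proper_on UNIV h"
  shows "conjugate_on UNIV h l \<noteq> -\<infinity>"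
proof -
  obtain v where "h v \<noteq> \<infinity>" "h v \<noteq> -\<infinity>" using assms by (auto simp: proper_on_def)
  then show ?thesis using fenchel_young[of v UNIV l h] by (cases "h v") auto
qed

lemma proper_conjugate:
  assumes "proper_on UNIV h" "l \<in> Lambda_dom h"
  shows "proper_on (Lambda_dom h) (conjugate_on UNIV h)"
  using assms conjugate_not_MInf[OF assms(1)] by (auto simp: proper_on_def Lambda_dom_def)

lemma effective_domain_conjugate: "effective_domain (Lambda_dom h) (conjugate_on UNIV h) = Lambda_dom h"
  by (auto simp: effective_domain_def Lambda_dom_def)

lemma conjugate_real:
  assumes "proper_on UNIV h" "l \<in> Lambda_dom h"
  shows "conjugate_on UNIV h l = ereal (real_of_ereal (conjugate_on UNIV h l))"
  using ereal_real_effective_domain[OF proper_conjugate[OF assms], of l] assms(2)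
  by (simp add: effective_domain_conjugate)

text \<open>Moving a point of the domain of \<open>h\<close> far in the direction \<open>- e\<^sub>j\<close> does not increase \<open>h\<close>, but
makes the pairing with \<open>l\<close> arbitrarily large if \<open>l\<^sub>j < 0\<close>.\<close>

lemma Lambda_dom_nonneg:
  fixes h :: "real^'m \<Rightarrow> ereal"
  assumes "proper_on UNIV h" "mono h" "l \<in> Lambda_dom h"
  shows "l $ j \<ge> 0"
proof (rule ccontr)
  assume neg: "\<not> l $ j \<ge> 0"
  define k where "k = real_of_ereal (conjugate_on UNIV h l)"
  have k: "conjugate_on UNIV h l \<le> ereal k"
    unfolding k_def using conjugate_real[OF assms(1,3)] by simp
  obtain v where v: "h v \<noteq> \<infinity>" using assms(1) by (auto simp: proper_on_def)
  then obtain c where c: "h v = ereal c" using assms(1) by (cases "h v") (auto simp: proper_on_def)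
  \<comment> \<open>chosen so that moving by \<open>s\<close> lifts the pairing above the bound \<open>k + c\<close>\<close>
  define s where "s = (\<bar>k - (l \<bullet> v - c)\<bar> + 1) / (- (l $ j))"
  have "s * (- (l $ j)) = \<bar>k - (l \<bullet> v - c)\<bar> + 1" using neg unfolding s_def by simp
  moreover have "s \<ge> 0" using neg unfolding s_def by (intro divide_nonneg_pos) auto
  ultimately have s: "s \<ge> 0" "s * (- (l $ j)) > k - (l \<bullet> v - c)" by linarith+
  define w where "w = v - s *\<^sub>R axis j 1"
  have "w \<le> v" using s(1) by (auto simp: less_eq_vec_def w_def axis_def)
  then have "h w \<le> ereal c" using assms(2) c by (metis monoD)
  then have wd: "w \<in> effective_domain UNIV h" by (auto simp: effective_domain_def)
  moreover have "real_of_ereal (h w) \<le> c"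
    using \<open>h w \<le> ereal c\<close> ereal_real_effective_domain[OF assms(1) wd]
    by (metis ereal_less_eq(3))
  ultimately have "l \<bullet> w - c \<le> k"
    using k conjugate_le_real_iff[OF assms(1)] by fastforce
  moreover have "l \<bullet> w = l \<bullet> v - s * (l $ j)"
    by (simp add: w_def inner_diff_right inner_axis)
  ultimately show False using s(2) by simp
qed

lemma conjugate_at_subgradient:
  assumes "l \<in> subdifferential h v" "h v = ereal c"
  shows "conjugate_on UNIV h l = ereal (l \<bullet> v - c)"
proof (rule antisym)
  show "conjugate_on UNIV h l \<le> ereal (l \<bullet> v - c)"
    unfolding conjugate_on_le_iff
  proof
    fix w
    have "ereal (c + l \<bullet> (w - v)) \<le> h w" using assms by (simp add: subdifferential_def)
    then show "ereal (l \<bullet> w) - h w \<le> ereal (l \<bullet> v - c)"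
      by (cases "h w") (auto simp: inner_simps)
  qed
  show "ereal (l \<bullet> v - c) \<le> conjugate_on UNIV h l"
    using fenchel_young[of v UNIV l h] assms(2) by simp
qed

section \<open>Exact penalties\<close>

text \<open>The point \<open>w\<close> minimizes \<open>h w - l \<bullet> w + r * norm (v - w)\<close>. The minimum exists because the conjugate is
finite at \<open>l\<close>, so that the first two terms are bounded below and the penalty is coercive. Separating the epigraph of
\<open>h\<close> from the region strictly below the concave function that touches it at \<open>w\<close> gives a slope
\<open>m\<close> that is a subgradient of \<open>h\<close>, while \<open>l - m\<close> is a subgradient of the penalty. The last two
conclusions say the latter: subgradients of \<open>r\<close> times the norm have norm at most \<open>r\<close>, and are
aligned with \<open>v - w\<close>.\<close>

lemma exact_penalty_subgradient:
  fixes h :: "real^'m \<Rightarrow> ereal"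
  assumes h: "closed_convex_on UNIV h" "proper_on UNIV h" and l: "l \<in> Lambda_dom h" and r: "r > 0"
  obtains w m c where "h w = ereal c" "m \<in> subdifferential h w" "norm (m - l) \<le> r"
    "r * norm (v - w) \<le> (m - l) \<bullet> (v - w)"
proof -
  define k where "k = real_of_ereal (conjugate_on UNIV h l)"
  have k: "conjugate_on UNIV h l = ereal k"
    unfolding k_def by (rule conjugate_real[OF h(2) l])
  define \<psi> where "\<psi> w = r * norm (v - w) - l \<bullet> w" for w
  have "ereal (l \<bullet> w - k) \<le> h w" for w
    using fenchel_young[of w UNIV l h] k by (cases "h w") (auto simp: algebra_simps)
  moreover have "bounded {w. (l \<bullet> w - k) + \<psi> w \<le> K}" for K
  proof -
    have "{w. (l \<bullet> w - k) + \<psi> w \<le> K} \<subseteq> cball v ((K + k) / r)"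
      using r by (auto simp: \<psi>_def dist_norm field_simps)
    then show ?thesis using bounded_cball bounded_subset by blast
  qed
  moreover have "continuous_on UNIV (\<lambda>w. l \<bullet> w - k)" "continuous_on UNIV \<psi>"
    unfolding \<psi>_def by (intro continuous_intros)+
  ultimately obtain w where w: "h w \<noteq> \<infinity>" "\<And>z. h w + ereal (\<psi> w) \<le> h z + ereal (\<psi> z)"
    using ex_minimizer_coercive[OF h, of "\<lambda>w. l \<bullet> w - k" \<psi>] by (metis UNIV_I)
  then obtain c where c: "h w = ereal c" using h(2) by (cases "h w") (auto simp: proper_on_def)
  have tri: "\<psi> (a *\<^sub>R y + b *\<^sub>R z) \<le> a * \<psi> y + b * \<psi> z" if "a \<ge> 0" "b \<ge> 0" "a + b = 1" for a b y z
  proof -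
    have "v - (a *\<^sub>R y + b *\<^sub>R z) = a *\<^sub>R (v - y) + b *\<^sub>R (v - z)"
      using that(3) by (simp add: algebra_simps flip: scaleR_add_left)
    then have "norm (v - (a *\<^sub>R y + b *\<^sub>R z)) \<le> a * norm (v - y) + b * norm (v - z)"
      using that norm_triangle_ineq[of "a *\<^sub>R (v - y)" "b *\<^sub>R (v - z)"] by simp
    then have "r * norm (v - (a *\<^sub>R y + b *\<^sub>R z)) \<le> r * (a * norm (v - y) + b * norm (v - z))"
      using r by (intro mult_left_mono) auto
    then show ?thesis by (simp add: \<psi>_def inner_simps algebra_simps)
  qed
  let ?A = "{(z, d::real). z \<in> UNIV \<and> h z \<le> ereal d}"
  let ?B = "{(z, d). d < c + \<psi> w - \<psi> z}"
  have "convex ?A" using h(1) by (simp add: closed_convex_on_def)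
  moreover have "convex ?B"
  proof (rule convexI)
    fix p q and a b :: real
    assume pq: "p \<in> ?B" "q \<in> ?B" and ab: "0 \<le> a" "0 \<le> b" "a + b = 1"
    let ?gap = "\<lambda>p. c + \<psi> w - \<psi> (fst p) - snd p"
    have "0 < a * ?gap p + b * ?gap q"
    proof (cases "a = 0")
      case False
      then have "0 < a * ?gap p" using pq ab by auto
      moreover have "0 \<le> b * ?gap q" using pq ab by auto
      ultimately show ?thesis by linarith
    qed (use pq ab in auto)
    also have "\<dots> = (a + b) * (c + \<psi> w) - (a * \<psi> (fst p) + b * \<psi> (fst q)) - (a * snd p + b * snd q)"
      by (simp add: algebra_simps)
    also have "\<dots> \<le> c + \<psi> w - \<psi> (a *\<^sub>R fst p + b *\<^sub>R fst q) - (a * snd p + b * snd q)"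
      using tri[OF ab, of "fst p" "fst q"] ab(3) by simp
    finally show "a *\<^sub>R p + b *\<^sub>R q \<in> ?B" by (simp add: case_prod_beta)
  qed
  moreover have "?A \<inter> ?B = {}"
  proof -
    have False if "h z \<le> ereal d" "d < c + \<psi> w - \<psi> z" for z d
    proof -
      have "ereal (c + \<psi> w) \<le> h z + ereal (\<psi> z)" using w(2)[of z] c by simp
      also have "\<dots> \<le> ereal d + ereal (\<psi> z)" using that(1) by (rule add_right_mono)
      finally show False using that(2) by simp
    qed
    then show ?thesis by auto
  qed
  moreover have "(w, c) \<in> ?A" "(w, c - 1) \<in> ?B" using c by simp_all
  ultimately obtain n \<beta> where n: "n \<noteq> 0" "\<And>z. z \<in> ?A \<Longrightarrow> n \<bullet> z \<le> \<beta>" "\<And>z. z \<in> ?B \<Longrightarrow> n \<bullet> z \<ge> \<beta>"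
    using separating_hyperplane_sets[of ?A ?B] by (metis (no_types, lifting) empty_iff)
  obtain a b where ab: "n = (a, b)" by (cases n)
  have A: "a \<bullet> z + b * d \<le> \<beta>" if "h z \<le> ereal d" for z d using n(2)[of "(z, d)"] that ab by simp
  have B: "a \<bullet> z + b * d \<ge> \<beta>" if "d < c + \<psi> w - \<psi> z" for z d using n(3)[of "(z, d)"] that ab by simp
  \<comment> \<open>The normal points downwards because the region lies below the epigraph at \<open>w\<close>, and is not
    horizontal because the region projects onto the whole space.\<close>
  have "b \<le> 0"
    using A[of w c] B[of "c - 1" w] c by (simp add: algebra_simps)
  moreover have "b \<noteq> 0"
  proof
    assume b: "b = 0"
    then have all: "a \<bullet> z \<ge> \<beta>" for z using B[of "c + \<psi> w - \<psi> z - 1" z] by simp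
    have "a \<bullet> w \<le> \<beta>" using A[of w c] c b by simp
    then have "a \<bullet> (w - a) \<ge> a \<bullet> w" using all[of "w - a"] by simp
    then have "a \<bullet> a \<le> 0" by (simp add: inner_simps)
    then have "a = 0" by (simp add: inner_gt_zero_iff flip: not_less)
    then show False using n(1) ab b by (simp add: zero_prod_def)
  qed
  ultimately have b: "b < 0" by simp
  define m where "m = (-1 / b) *\<^sub>R a"
  have m: "a \<bullet> z = - b * (m \<bullet> z)" for z using b by (simp add: m_def)
  \<comment> \<open>closing the strict inequality that defines the second set\<close>
  have B': "a \<bullet> z + b * (c + \<psi> w - \<psi> z) \<ge> \<beta>" for z
  proof (rule field_le_epsilon)
    fix e :: real assume "e > 0"
    then show "\<beta> \<le> a \<bullet> z + b * (c + \<psi> w - \<psi> z) + e"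
    proof -
      have "b * (c + \<psi> w - \<psi> z - e / (- b)) = b * (c + \<psi> w - \<psi> z) + e"
        using b by (simp add: algebra_simps)
      moreover have "e / (- b) > 0" using b \<open>e > 0\<close> by (intro divide_pos_pos) auto
      ultimately show ?thesis using B[of "c + \<psi> w - \<psi> z - e / (- b)" z] by simp
    qed
  qed
  have sub1: "c + m \<bullet> (z - w) \<le> d" if "h z \<le> ereal d" for z d
  proof -
    have "a \<bullet> z + b * d \<le> a \<bullet> w + b * c" using A[OF that] B'[of w] by simp
    then have "(- b) * (c + m \<bullet> (z - w)) \<le> (- b) * d" unfolding m by (simp add: inner_simps algebra_simps)
    then show ?thesis using b by simp
  qed
  have sub2: "m \<bullet> (z - w) \<ge> \<psi> w - \<psi> z" for z
  proof -
    have "a \<bullet> w + b * c \<le> a \<bullet> z + b * (c + \<psi> w - \<psi> z)" using A[of w c] c B'[of z] by simp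
    then have "(- b) * (\<psi> w - \<psi> z) \<le> (- b) * (m \<bullet> (z - w))" unfolding m by (simp add: inner_simps algebra_simps)
    then show ?thesis using b by simp
  qed
  show thesis
  proof (rule that[OF c])
    show "m \<in> subdifferential h w"
      unfolding subdifferential_def
    proof (intro CollectI allI)
      fix z show "h w + ereal (m \<bullet> (z - w)) \<le> h z"
        using sub1[of z] c h(2) by (cases "h z") (auto simp: proper_on_def)
    qed
    show "norm (m - l) \<le> r"
    proof -
      \<comment> \<open>Testing the subgradient inequality in the direction of \<open>l - m\<close> gives the norm bound.\<close>
      define z where "z = w - (m - l)"
      have "(norm (m - l))\<^sup>2 \<le> r * (norm (v - z) - norm (v - w))"
        using sub2[of z] by (simp add: \<psi>_def z_def power2_norm_eq_inner inner_simps algebra_simps)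
      also have "\<dots> \<le> r * norm (m - l)"
        using r norm_triangle_ineq2[of "v - z" "v - w"] by (simp add: z_def norm_minus_commute)
      finally show ?thesis using r by (cases "m = l") (simp_all add: power2_eq_square)
    qed
    show "r * norm (v - w) \<le> (m - l) \<bullet> (v - w)"
      using sub2[of v] by (simp add: \<psi>_def inner_simps)
  qed
qed

section \<open>Smooth convex functions on a convex set\<close>

lemma has_real_derivative_along_segment:
  fixes f :: "'a::euclidean_space \<Rightarrow> real"
  assumes der: "\<And>v. v \<in> X \<Longrightarrow> (f has_derivative (\<lambda>d. df v \<bullet> d)) (at v within X)"
    and X: "convex X" "v \<in> X" "w \<in> X" and s: "s \<in> {0..1}"
  shows "((\<lambda>s. f (v + s *\<^sub>R (w - v))) has_real_derivative df (v + s *\<^sub>R (w - v)) \<bullet> (w - v)) (at s within {0..1})"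
proof -
  have seg: "v + s *\<^sub>R (w - v) \<in> X" if "s \<in> {0..1}" for s
    using convexD_alt[OF X, of s] that by (simp add: algebra_simps)
  have "((\<lambda>s. f (v + s *\<^sub>R (w - v))) has_derivative (\<lambda>t. df (v + s *\<^sub>R (w - v)) \<bullet> (t *\<^sub>R (w - v)))) (at s within {0..1})"
  proof (rule has_derivative_in_compose2[of X f "\<lambda>v d. df v \<bullet> d"])
    show "((\<lambda>s. v + s *\<^sub>R (w - v)) has_derivative (\<lambda>t. t *\<^sub>R (w - v))) (at s within {0..1})"
      by (auto intro!: derivative_eq_intros)
  qed (use seg s der in auto)
  then show ?thesis unfolding has_field_derivative_def by (simp add: mult.commute[of _ "_ \<bullet> _"] fun_eq_iff[symmetric])
qed

text \<open>The difference quotients along the segment from \<open>v\<close> to \<open>w\<close> are bounded by their value at the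
far end. Derivatives are taken within \<open>X\<close>, so only the one-sided derivative at \<open>v\<close> is available.\<close>

lemma convex_gradient_inequality:
  fixes f :: "'a::euclidean_space \<Rightarrow> real"
  assumes f: "convex_on X f" and der: "\<And>v. v \<in> X \<Longrightarrow> (f has_derivative (\<lambda>d. df v \<bullet> d)) (at v within X)"
    and vw: "v \<in> X" "w \<in> X"
  shows "f v + df v \<bullet> (w - v) \<le> f w"
proof -
  have "((\<lambda>s. f (v + s *\<^sub>R (w - v))) has_real_derivative df v \<bullet> (w - v)) (at 0 within {0..1})"
    using has_real_derivative_along_segment[of X f df v w 0] der vw convex_on_imp_convex[OF f] by simp
  then have "((\<lambda>s. (f (v + s *\<^sub>R (w - v)) - f v) / s) \<longlongrightarrow> df v \<bullet> (w - v)) (at 0 within {0..1})"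
    by (simp add: has_field_derivative_iff)
  moreover have "at (0::real) within {0..1} = at_right 0"
    using at_within_Icc_at_right[of 0 "1::real"] by simp
  ultimately have lim: "((\<lambda>s. (f (v + s *\<^sub>R (w - v)) - f v) / s) \<longlongrightarrow> df v \<bullet> (w - v)) (at_right 0)" by simp
  have "df v \<bullet> (w - v) \<le> f w - f v"
  proof (rule tendsto_upperbound[OF lim])
    have "(f (v + s *\<^sub>R (w - v)) - f v) / s \<le> f w - f v" if s: "0 < s" "s < 1" for s
    proof -
      have "f (v + s *\<^sub>R (w - v)) \<le> (1 - s) * f v + s * f w"
        using convex_onD[OF f, of s v w] s vw by (simp add: algebra_simps)
      then show ?thesis using s by (simp add: field_simps)
    qed
    then show "\<forall>\<^sub>F s in at_right 0. (f (v + s *\<^sub>R (w - v)) - f v) / s \<le> f w - f v"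
      using eventually_at_right_real[of 0 1] by (auto elim: eventually_mono)
  qed simp
  then show ?thesis by simp
qed

text \<open>Along the segment from \<open>v\<close> to \<open>w\<close>, the function minus its linearization and minus the quadratic
has a nonpositive derivative, by the Lipschitz bound on the gradient.\<close>

lemma descent_inequality:
  fixes f :: "'a::euclidean_space \<Rightarrow> real"
  assumes der: "\<And>v. v \<in> X \<Longrightarrow> (f has_derivative (\<lambda>d. df v \<bullet> d)) (at v within X)"
    and lip: "K-lipschitz_on X df"
    and X: "convex X" "v \<in> X" "w \<in> X"
  shows "f w \<le> f v + df v \<bullet> (w - v) + K / 2 * (norm (w - v))\<^sup>2"
proof -
  define \<phi> where "\<phi> s = f (v + s *\<^sub>R (w - v)) - s * (df v \<bullet> (w - v)) - K / 2 * s\<^sup>2 * (norm (w - v))\<^sup>2" for s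
  define \<phi>' where "\<phi>' s = df (v + s *\<^sub>R (w - v)) \<bullet> (w - v) - df v \<bullet> (w - v) - K * s * (norm (w - v))\<^sup>2" for s
  have der\<phi>: "(\<phi> has_real_derivative \<phi>' s) (at s within {0..1})" if "s \<in> {0..1}" for s
    unfolding \<phi>_def \<phi>'_def
    by (rule derivative_eq_intros has_real_derivative_along_segment[OF der X that] refl | simp)+
  have neg: "\<phi>' s \<le> 0" if "s \<in> {0..1}" for s
  proof -
    let ?z = "v + s *\<^sub>R (w - v)"
    have z: "?z \<in> X" using convexD_alt[OF X, of s] that by (simp add: algebra_simps)
    have "(df ?z - df v) \<bullet> (w - v) \<le> norm (df ?z - df v) * norm (w - v)" by (rule norm_cauchy_schwarz)
    also have "\<dots> \<le> (K * norm (?z - v)) * norm (w - v)"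
      using lipschitz_onD[OF lip z X(2)] by (intro mult_right_mono) (simp_all add: dist_norm)
    also have "\<dots> = K * s * (norm (w - v))\<^sup>2" using that by (simp add: power2_eq_square)
    finally show ?thesis by (simp add: \<phi>'_def inner_diff_left)
  qed
  have "\<exists>s\<in>{0..1}. \<phi> 1 - \<phi> 0 = (1 - 0) * \<phi>' s"
    by (rule mvt_very_simple[where f'="\<lambda>s t. t * \<phi>' s", simplified])
      (use der\<phi> in \<open>auto simp: has_field_derivative_def mult.commute[of _ "\<phi>' _"]\<close>)
  then have "\<phi> 1 \<le> \<phi> 0" using neg by force
  then show ?thesis by (simp add: \<phi>_def algebra_simps)
qed

section \<open>Matrices, extremal points, and averages\<close>

lemma norm_matrix_vector_le: "norm (A *v v) \<le> spectral_norm A * norm v"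
  unfolding spectral_norm_def by (rule onorm) (rule matrix_vector_mul_bounded_linear)

lemma spectral_norm_nonneg: "0 \<le> spectral_norm A"
  unfolding spectral_norm_def by (rule onorm_pos_le) (rule matrix_vector_mul_bounded_linear)

lemma inner_transpose_matrix_vector:
  fixes A :: "real^'n^'m"
  shows "(transpose A *v l) \<bullet> v = l \<bullet> (A *v v)"
  by (simp add: dot_lmul_matrix)

lemma arg_min_attained:
  fixes f :: "'a \<Rightarrow> 'b::linorder"
  assumes "v \<in> S" "\<And>w. w \<in> S \<Longrightarrow> f v \<le> f w"
  shows "arg_min f (\<lambda>v. v \<in> S) \<in> S"
    and "w \<in> S \<Longrightarrow> f (arg_min f (\<lambda>v. v \<in> S)) \<le> f w"
proof -
  have "is_arg_min f (\<lambda>v. v \<in> S) v" using assms by (auto simp: is_arg_min_def not_less)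
  then have "is_arg_min f (\<lambda>v. v \<in> S) (arg_min f (\<lambda>v. v \<in> S))"
    unfolding arg_min_def by (rule someI)
  then show "arg_min f (\<lambda>v. v \<in> S) \<in> S" "w \<in> S \<Longrightarrow> f (arg_min f (\<lambda>v. v \<in> S)) \<le> f w"
    by (auto simp: is_arg_min_def not_less)
qed

lemma arg_max_attained:
  fixes f :: "'a \<Rightarrow> 'b::linorder"
  assumes "v \<in> S" "\<And>w. w \<in> S \<Longrightarrow> f w \<le> f v"
  shows "arg_max f (\<lambda>v. v \<in> S) \<in> S"
    and "w \<in> S \<Longrightarrow> f w \<le> f (arg_max f (\<lambda>v. v \<in> S))"
proof -
  have "is_arg_max f (\<lambda>v. v \<in> S) v" using assms by (auto simp: is_arg_max_def not_less)
  then have "is_arg_max f (\<lambda>v. v \<in> S) (arg_max f (\<lambda>v. v \<in> S))"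
    unfolding arg_max_def by (rule someI)
  then show "arg_max f (\<lambda>v. v \<in> S) \<in> S" "w \<in> S \<Longrightarrow> f w \<le> f (arg_max f (\<lambda>v. v \<in> S))"
    by (auto simp: is_arg_max_def not_less)
qed

lemma transpose_scaleR: "transpose (c *\<^sub>R A) = c *\<^sub>R transpose (A :: real^'a^'b)"
  by (simp add: transpose_def vec_eq_iff)

lemma sum_upto_last_int:
  fixes f :: "int \<Rightarrow> 'b::comm_monoid_add"
  assumes "k \<ge> 1"
  shows "(\<Sum>s=1..k. f s) = (\<Sum>s=1..k - 1. f s) + f k"
proof -
  have "{1..k} = insert k {1..k - 1}" using assms by auto
  then show ?thesis by (simp add: add.commute)
qed

lemma sum_of_int: "0 \<le> t \<Longrightarrow> (\<Sum>k=1..t. of_int k) = (of_int t * (of_int t + 1) / 2 :: real)"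
proof (induction t rule: int_ge_induct)
  case (step t)
  then show ?case using sum_upto_last_int[of "t + 1" "of_int :: int \<Rightarrow> real"] by (simp add: field_simps)
qed simp

text \<open>The averages with weights \<open>1, \<dots>, n\<close> are updated by convex combinations with these two coefficients.\<close>

lemma averaging_weights:
  fixes n :: real
  assumes "n \<ge> 1"
  shows "0 \<le> (n - 1) / (n + 1)" "0 \<le> 2 / (n + 1)" "(n - 1) / (n + 1) + 2 / (n + 1) = 1"
proof -
  have "(n - 1) + 2 = n + 1" by simp
  then show "(n - 1) / (n + 1) + 2 / (n + 1) = 1"
    unfolding add_divide_distrib[symmetric] using assms by simp
qed (use assms in simp_all)

lemma averaging_weight_shift:
  fixes n :: real
  assumes "n > 1"
  shows "(n - 1) / (n + 1) * (2 / ((n - 1) * (n - 1 + 1))) = 2 / (n * (n + 1))"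
  using mult_divide_mult_cancel_left[of "n - 1" 2 "n * (n + 1)"] assms by (simp add: mult_ac)

section \<open>One primal-dual step\<close>

text \<open>The potential after a step that produced \<open>(y, l)\<close> from a dual iterate \<open>l'\<close>, relative to the comparison
point \<open>(xr, lr)\<close>. The inner product is the part of the coupling that the next extrapolation cancels, and
\<open>c / 2 * (norm (l - l'))\<^sup>2\<close> pays for the error of that extrapolation.\<close>

definition step_potential ::
    "real^'n \<Rightarrow> real^'m \<Rightarrow> real \<Rightarrow> real \<Rightarrow> real^'n^'m \<Rightarrow> real^'m \<Rightarrow> real^'m \<Rightarrow> real^'n \<Rightarrow> real" where
  "step_potential xr lr b c N l l' y =
     (l - l') \<bullet> (N *v (y - xr)) - c / 2 * (norm (l - l'))\<^sup>2
     - b / 2 * (norm (xr - y))\<^sup>2 - c / 2 * (norm (lr - l))\<^sup>2"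

text \<open>The sum of the two three-point inequalities. Here \<open>N\<close> is the current coupling matrix, \<open>N'\<close> the one
used to extrapolate, and \<open>l\<close>, \<open>l1\<close>, \<open>l2\<close> are three consecutive dual iterates. What remains of the coupling is
\<open>(l - l1) \<bullet> N (y - xr) - (l1 - l2) \<bullet> N' (y - xr)\<close>, and replacing \<open>y\<close> by \<open>y1\<close> in the second product makes this a
difference of potentials; the hypothesis \<open>cross\<close> is exactly what absorbs the correction.\<close>

lemma primal_dual_step:
  fixes N N' :: "real^'n^'m"
  assumes primal: "Uy + prox_model (transpose N *v l1 + transpose N' *v (l1 - l2)) a xp b y1 y
        + (a + b) / 2 * (norm (xr - y))\<^sup>2
      \<le> Ux + prox_model (transpose N *v l1 + transpose N' *v (l1 - l2)) a xp b y1 xr"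
    and dual: "Hl + prox_model (- (N *v (y - xu) + gu)) 0 p c l1 l + (0 + c) / 2 * (norm (lr - l))\<^sup>2
      \<le> Hr + prox_model (- (N *v (y - xu) + gu)) 0 p c l1 lr"
    and cross: "\<bar>(l1 - l2) \<bullet> (N' *v (y - y1))\<bar>
      \<le> b / 2 * (norm (y - y1))\<^sup>2 + c / 2 * (norm (l1 - l2))\<^sup>2"
  shows "lr \<bullet> (N *v (y - xu) + gu) - Hr + Uy - (l \<bullet> (N *v (xr - xu) + gu) - Hl + Ux)
      + a / 2 * ((norm (y - xp))\<^sup>2 + (norm (xr - y))\<^sup>2 - (norm (xr - xp))\<^sup>2)
    \<le> step_potential xr lr b c N l l1 y - step_potential xr lr b c N' l1 l2 y1"
proof -
  have e1: "(transpose N *v l1 + transpose N' *v (l1 - l2)) \<bullet> (y - xr)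
      = l1 \<bullet> (N *v (y - xr)) + (l1 - l2) \<bullet> (N' *v (y - xr))"
    by (simp add: inner_add_left inner_transpose_matrix_vector del: transpose_matrix_vector)
  have e2: "l \<bullet> (N *v (xr - xu) + gu) = l \<bullet> (N *v (y - xu) + gu) - l \<bullet> (N *v (y - xr))"
  proof -
    have "xr - xu = (y - xu) - (y - xr)" by simp
    then show ?thesis by (simp only: matrix_vector_mult_diff_distrib inner_simps)
  qed
  have e3: "(l1 - l2) \<bullet> (N' *v (y - xr))
      = (l1 - l2) \<bullet> (N' *v (y - y1)) + (l1 - l2) \<bullet> (N' *v (y1 - xr))"
  proof -
    have "y - xr = (y - y1) + (y1 - xr)" by simp
    then show ?thesis by (simp only: matrix_vector_right_distrib inner_simps)
  qed
  have p: "(transpose N *v l1 + transpose N' *v (l1 - l2)) \<bullet> (y - xr) + Uy - Ux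
      + a / 2 * ((norm (y - xp))\<^sup>2 + (norm (xr - y))\<^sup>2 - (norm (xr - xp))\<^sup>2)
      + b / 2 * ((norm (y - y1))\<^sup>2 + (norm (xr - y))\<^sup>2 - (norm (xr - y1))\<^sup>2) \<le> 0"
    using primal unfolding prox_model_def inner_diff_right
    by (simp add: algebra_simps add_divide_distrib)
  have d: "lr \<bullet> (N *v (y - xu) + gu) - l \<bullet> (N *v (y - xu) + gu) + Hl - Hr
      + c / 2 * ((norm (l - l1))\<^sup>2 + (norm (lr - l))\<^sup>2 - (norm (lr - l1))\<^sup>2) \<le> 0"
    using dual unfolding prox_model_def inner_minus_left inner_commute[of "N *v (y - xu) + gu"]
    by (simp add: algebra_simps)
  have e4: "step_potential xr lr b c N l l1 y - step_potential xr lr b c N' l1 l2 y1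
      = l \<bullet> (N *v (y - xr)) - l1 \<bullet> (N *v (y - xr)) - (l1 - l2) \<bullet> (N' *v (y1 - xr))
      - c / 2 * ((norm (l - l1))\<^sup>2 + (norm (lr - l))\<^sup>2 - (norm (lr - l1))\<^sup>2)
      + c / 2 * (norm (l1 - l2))\<^sup>2 - b / 2 * (norm (xr - y))\<^sup>2 + b / 2 * (norm (xr - y1))\<^sup>2"
    unfolding step_potential_def by (simp add: inner_diff_left algebra_simps)
  show ?thesis
    using p d cross e1 e2 e3 e4 by (simp add: algebra_simps)
qed

section \<open>Executions and the saddle point\<close>

text \<open>One execution of the algorithm with the adaptive stepsizes, for a fixed problem and saddle point.
The matrix component of the saddle point is the gradient of \<open>g\<close> at \<open>xs\<close>.\<close>

locale ufcm_execution =
  fixes X :: "(real^'n) set"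
    and u :: "real^'n \<Rightarrow> ereal"
    and g :: "real^'n \<Rightarrow> real^'m"
    and G :: "real^'n \<Rightarrow> real^'n^'m"
    and h :: "real^'m \<Rightarrow> ereal"
    and Ls :: "'m \<Rightarrow> real"
    and x0 xs :: "real^'n" and l0 ls :: "real^'m"
    and C \<Delta> r :: real
    and T :: int
    and x xt xu :: "int \<Rightarrow> real^'n" and nu :: "int \<Rightarrow> real^'n^'m"
    and y :: "int \<Rightarrow> int \<Rightarrow> real^'n" and lam :: "int \<Rightarrow> int \<Rightarrow> real^'m"
    and lt :: "int \<Rightarrow> real^'m"
    and xbar :: "real^'n" and lbar :: "real^'m"
  assumes X: "convex X"
    and u: "closed_convex_on X u" "proper_on X u"
    and h: "closed_convex_on UNIV h" "proper_on UNIV h" "mono h"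
    and g: "\<And>j. closed_convex_on X (\<lambda>v. ereal (g v $ j))"
           "\<And>j. smooth_on X (Ls j) (\<lambda>v. g v $ j) (\<lambda>v. G v $ j)"
    and saddle: "saddle_point X u g h xs ls (G xs)"
    and pos: "C > 0" "\<Delta> > 0" "r > 0"
    and x0: "x0 \<in> X"
    and T: "T \<ge> 1"
    and run: "ufcm_run X u g G h (CD_stepsizes (L_ADA Ls ls r) C \<Delta> nu) x0 l0 T
                x xt xu nu y lam lt xbar lbar"
    and inner_pos: "\<And>t. t \<in> {1..T} \<Longrightarrow> CD_inner \<Delta> nu t \<ge> 1"
begin

abbreviation L :: real where "L \<equiv> L_ADA Ls ls r"
abbreviation S :: "int \<Rightarrow> int" where "S \<equiv> CD_inner \<Delta> nu"
abbreviation Mt :: "int \<Rightarrow> real" where "Mt \<equiv> CD_Mt \<Delta> nu"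
abbreviation domu :: "(real^'n) set" where "domu \<equiv> effective_domain X u"
abbreviation U :: "real^'n \<Rightarrow> real" where "U v \<equiv> real_of_ereal (u v)"
abbreviation H :: "real^'m \<Rightarrow> real" where "H l \<equiv> real_of_ereal (conjugate_on UNIV h l)"

lemma xs_X: "xs \<in> X" and ls_Lambda: "ls \<in> Lambda_dom h"
  using saddle by (simp_all add: saddle_point_def)

lemma Ls_nonneg: "Ls j \<ge> 0"
  using g(2)[of j] lipschitz_on_nonneg by (auto simp: smooth_on_def)

lemma Lambda_nonneg: "l \<in> Lambda_dom h \<Longrightarrow> l $ j \<ge> 0"
  by (rule Lambda_dom_nonneg[OF h(2,3)])

lemma L_nonneg: "L \<ge> 0"
  unfolding L_ADA_def using Ls_nonneg Lambda_nonneg[OF ls_Lambda] pos(3)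
  by (intro sum_nonneg mult_nonneg_nonneg add_nonneg_nonneg) auto

lemma g_convex: "convex_on X (\<lambda>v. g v $ j)"
proof -
  have p: "effective_domain X (\<lambda>v. ereal (g v $ j)) = X" "proper_on X (\<lambda>v. ereal (g v $ j))"
    using x0 by (auto simp: effective_domain_def proper_on_def)
  show ?thesis using closed_convex_on_imp_convex_on[OF g(1)[of j] p(2)] p(1) by simp
qed

lemma g_gradient_inequality:
  assumes "v \<in> X" "w \<in> X"
  shows "g v $ j + G v $ j \<bullet> (w - v) \<le> g w $ j"
  using convex_gradient_inequality[OF g_convex, of j "\<lambda>v. G v $ j" v w] g(2)[of j] assms
  by (auto simp: smooth_on_def)

text \<open>Multipliers are nonnegative, so componentwise convexity of \<open>g\<close> carries over to \<open>l \<bullet> g\<close>.\<close>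

lemma linearization_le:
  assumes "l \<in> Lambda_dom h" "v \<in> X" "w \<in> X"
  shows "l \<bullet> (G v *v (w - v) + g v) \<le> l \<bullet> g w"
  unfolding inner_vec_def
proof (rule sum_mono)
  fix j
  have "l $ j * (g v $ j + G v $ j \<bullet> (w - v)) \<le> l $ j * g w $ j"
    by (rule mult_left_mono[OF g_gradient_inequality[OF assms(2,3)] Lambda_nonneg[OF assms(1)]])
  then show "l $ j \<bullet> (G v *v (w - v) + g v) $ j \<le> l $ j \<bullet> g w $ j"
    by (simp add: matrix_vector_mul_component add.commute)
qed

text \<open>The radius \<open>r\<close> enters the aggregate constant here: \<open>norm (l - ls) \<le> r\<close> gives \<open>l $ j \<le> ls $ j + r\<close>, so
\<open>L\<close> is a smoothness constant of \<open>l \<bullet> g\<close> for every such \<open>l\<close> at once.\<close>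

lemma smooth_upper_bound:
  assumes "l \<in> Lambda_dom h" "norm (l - ls) \<le> r" "v \<in> X" "w \<in> X"
  shows "l \<bullet> g w \<le> l \<bullet> (G v *v (w - v) + g v) + L / 2 * (norm (w - v))\<^sup>2"
proof -
  have "l \<bullet> g w \<le> (\<Sum>j\<in>UNIV. l $ j * (G v *v (w - v) + g v) $ j + (ls $ j + r) * Ls j * ((norm (w - v))\<^sup>2 / 2))"
    unfolding inner_vec_def
  proof (rule sum_mono)
    fix j
    have "l $ j * g w $ j \<le> l $ j * (g v $ j + G v $ j \<bullet> (w - v) + Ls j / 2 * (norm (w - v))\<^sup>2)"
      using g(2)[of j] X assms(3,4) Lambda_nonneg[OF assms(1), of j]
      by (intro mult_left_mono descent_inequality[where X=X]) (auto simp: smooth_on_def)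
    also have "\<dots> = l $ j * (G v *v (w - v) + g v) $ j + l $ j * Ls j * ((norm (w - v))\<^sup>2 / 2)"
      by (simp add: matrix_vector_mul_component algebra_simps)
    also have "l $ j * Ls j * ((norm (w - v))\<^sup>2 / 2) \<le> (ls $ j + r) * Ls j * ((norm (w - v))\<^sup>2 / 2)"
    proof -
      have "\<bar>(l - ls) $ j\<bar> \<le> r" using component_le_norm_cart[of "l - ls" j] assms(2) by linarith
      then have "l $ j \<le> ls $ j + r" by simp
      then show ?thesis using Ls_nonneg[of j] by (intro mult_right_mono) auto
    qed
    finally show "l $ j \<bullet> g w $ j \<le> l $ j * (G v *v (w - v) + g v) $ j
        + (ls $ j + r) * Ls j * ((norm (w - v))\<^sup>2 / 2)" by simp
  qed
  also have "\<dots> = l \<bullet> (G v *v (w - v) + g v) + L / 2 * (norm (w - v))\<^sup>2"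
    unfolding inner_vec_def L_ADA_def by (simp add: sum.distrib sum_distrib_right sum_divide_distrib)
  finally show ?thesis .
qed

text \<open>Equality in the Fenchel-Young inequality at a gradient; it makes the Lagrangian at \<open>G xs\<close> explicit.\<close>

lemma g_conj_gradient: "g_conj X g (G xs) = G xs *v xs - g xs"
proof -
  have "conjugate_on X (\<lambda>v. ereal (g v $ j)) (G xs $ j) = ereal (G xs $ j \<bullet> xs - g xs $ j)" for j
  proof (rule antisym)
    show "conjugate_on X (\<lambda>v. ereal (g v $ j)) (G xs $ j) \<le> ereal (G xs $ j \<bullet> xs - g xs $ j)"
      unfolding conjugate_on_le_iff
      using g_gradient_inequality[OF xs_X, of _ j] by (fastforce simp: inner_diff_right)
    show "ereal (G xs $ j \<bullet> xs - g xs $ j) \<le> conjugate_on X (\<lambda>v. ereal (g v $ j)) (G xs $ j)"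
      using fenchel_young[OF xs_X, of "G xs $ j" "\<lambda>v. ereal (g v $ j)"] by simp
  qed
  then show ?thesis by (simp add: g_conj_def vec_eq_iff matrix_vector_mul_component)
qed

lemma lagrangian_gradient:
  assumes "l \<in> Lambda_dom h"
  shows "lagrangian X u g h v l (G xs) = ereal (l \<bullet> (G xs *v (v - xs) + g xs) - H l) + u v"
proof -
  have "lagrangian X u g h v l (G xs)
      = ereal (l \<bullet> (G xs *v v - (G xs *v xs - g xs))) - ereal (H l) + u v"
    unfolding lagrangian_def g_conj_gradient using conjugate_real[OF h(2) assms] by simp
  then show ?thesis by (simp add: matrix_vector_mult_diff_distrib algebra_simps)
qed

definition saddle_value :: real where "saddle_value = ls \<bullet> g xs - H ls + U xs"

lemma u_real: "v \<in> domu \<Longrightarrow> u v = ereal (U v)"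
  by (rule ereal_real_effective_domain[OF u(2)])

text \<open>If \<open>u\<close> were infinite at \<open>xs\<close>, the saddle inequality would make it infinite everywhere.\<close>

lemma xs_dom: "xs \<in> domu"
proof -
  obtain v where v: "v \<in> X" "u v \<noteq> \<infinity>" using u(2) by (auto simp: proper_on_def)
  have "lagrangian X u g h xs ls (G xs) \<le> lagrangian X u g h v ls (G xs)"
    using saddle v by (simp add: saddle_point_def)
  then show ?thesis
    using v xs_X unfolding lagrangian_gradient[OF ls_Lambda]
    by (cases "u v"; cases "u xs") (auto simp: effective_domain_def)
qed

lemma lagrangian_gradient_real:
  assumes "l \<in> Lambda_dom h" "v \<in> domu"
  shows "lagrangian X u g h v l (G xs) = ereal (l \<bullet> (G xs *v (v - xs) + g xs) - H l + U v)"
  using lagrangian_gradient[OF assms(1), of v] u_real[OF assms(2)] by (metis plus_ereal.simps(1))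

lemma saddle_dual:
  assumes "l \<in> Lambda_dom h"
  shows "l \<bullet> g xs - H l + U xs \<le> saddle_value"
proof -
  have "G xs \<in> V_dom X g" using saddle by (simp add: saddle_point_def)
  then have "lagrangian X u g h xs l (G xs) \<le> lagrangian X u g h xs ls (G xs)"
    using saddle assms by (simp add: saddle_point_def)
  then show ?thesis
    by (simp add: lagrangian_gradient_real xs_dom ls_Lambda assms saddle_value_def)
qed

lemma saddle_primal:
  assumes "v \<in> domu"
  shows "saddle_value \<le> ls \<bullet> g v - H ls + U v"
proof -
  have v: "v \<in> X" using assms by (simp add: effective_domain_def)
  have "lagrangian X u g h xs ls (G xs) \<le> lagrangian X u g h v ls (G xs)"
    using saddle v by (simp add: saddle_point_def)
  then have "saddle_value \<le> ls \<bullet> (G xs *v (v - xs) + g xs) - H ls + U v"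
    by (simp add: lagrangian_gradient_real xs_dom ls_Lambda assms saddle_value_def)
  also have "ls \<bullet> (G xs *v (v - xs) + g xs) \<le> ls \<bullet> g v"
    by (rule linearization_le[OF ls_Lambda xs_X v])
  finally show ?thesis by simp
qed

text \<open>Weak duality: the Fenchel-Young inequality for \<open>h\<close> at \<open>g v\<close> and \<open>ls\<close>.\<close>

lemma saddle_value_le_opt: "ereal saddle_value \<le> opt_value X u g h"
  unfolding opt_value_def
proof (rule INF_greatest)
  fix v assume v: "v \<in> X"
  show "ereal saddle_value \<le> h (g v) + u v"
  proof (cases "u v = \<infinity>")
    case True
    have "h (g v) \<noteq> -\<infinity>" using h(2) by (simp add: proper_on_def)
    then show ?thesis using True by simp
  next
    case False
    then have vd: "v \<in> domu" using v by (simp add: effective_domain_def)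
    have "ereal (ls \<bullet> g v - H ls) \<le> h (g v)"
    proof (cases "h (g v)")
      case (real c)
      then show ?thesis
        using fenchel_young[of "g v" UNIV ls h] conjugate_real[OF h(2) ls_Lambda]
        by (metis UNIV_I add.commute add_diff_eq diff_le_eq ereal_less_eq(3) ereal_minus(1))
    qed (use h(2) in \<open>auto simp: proper_on_def\<close>)
    then have "ereal (ls \<bullet> g v - H ls) + u v \<le> h (g v) + u v" by (rule add_right_mono)
    moreover have "ereal saddle_value \<le> ereal (ls \<bullet> g v - H ls) + u v"
      using saddle_primal[OF vd] u_real[OF vd] by (metis ereal_less_eq(3) plus_ereal.simps(1))
    ultimately show ?thesis by (rule order_trans[rotated])
  qed
qed

section \<open>The generated sequences\<close>

lemma run_start: "x (-1) = x0" "x 0 = x0" "xu 0 = x0" "y 1 0 = x0" "lam 1 (-1) = l0" "lam 1 0 = l0"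
  using run by (simp_all add: ufcm_run_def)

lemma run_extrapolation:
  assumes "t \<in> {1..T}"
  shows "xt t = x (t - 1) + ((of_int t - 1) / of_int t) *\<^sub>R (x (t - 1) - x (t - 2))"
proof -
  have "xt t = x (t - 1) + ((of_int t - 1) / 2 / ((of_int (t - 1) - 1) / 2 + 1)) *\<^sub>R (x (t - 1) - x (t - 2))"
    using run assms by (simp add: ufcm_run_def CD_stepsizes_def Let_def)
  moreover have "(of_int t - 1) / 2 / ((of_int (t - 1) - 1) / 2 + 1) = (of_int t - 1) / (of_int t :: real)"
  proof -
    have half: "(of_int (t - 1) - 1) / 2 + 1 = (of_int t / 2 :: real)" by (simp add: field_simps)
    have "a / 2 / (c / 2) = a / c" for a c :: real by simp
    then show ?thesis unfolding half .
  qed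
  ultimately show ?thesis by (simp only:)
qed

lemma run_linearization_point:
  assumes "t \<in> {1..T}"
  shows "xu t = (1 / (1 + (of_int t - 1) / 2)) *\<^sub>R (((of_int t - 1) / 2) *\<^sub>R xu (t - 1) + xt t)"
  using run assms by (simp add: ufcm_run_def CD_stepsizes_def Let_def)

lemma run_average:
  assumes "t \<in> {1..T}"
  shows "x t = (1 / of_int (S t)) *\<^sub>R (\<Sum>s=1..S t. y t s)"
  using run assms by (simp add: ufcm_run_def CD_stepsizes_def Let_def)

lemma run_gradient: "t \<in> {1..T} \<Longrightarrow> nu t = G (xu t)"
  using run by (simp add: ufcm_run_def)

lemma run_restart:
  assumes "t \<in> {1..T}"
  shows "lam (t + 1) 0 = lam t (S t)" "lam (t + 1) (-1) = lam t (S t - 1)" "y (t + 1) 0 = y t (S t)"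
  using run assms by (simp_all add: ufcm_run_def CD_stepsizes_def Let_def)

lemma run_output:
  "xbar = (1 / (\<Sum>t=1..T. of_int t)) *\<^sub>R (\<Sum>t=1..T. of_int t *\<^sub>R x t)"
  using run by (simp add: ufcm_run_def CD_stepsizes_def Let_def)

text \<open>The matrix to which the difference of the dual iterates \<open>s\<close> and \<open>s - 1\<close> of phase \<open>t\<close> is applied in the
next extrapolation. At \<open>s = 0\<close> that difference belongs to the previous phase, whose matrix is rescaled by \<open>\<rho>\<close>. With
this convention all inner steps have the same form.\<close>

definition coupling :: "int \<Rightarrow> int \<Rightarrow> real^'n^'m" where
  "coupling t s = (if s = 0 then (Mt t / Mt (t - 1)) *\<^sub>R nu (t - 1) else nu t)"

abbreviation direction :: "int \<Rightarrow> int \<Rightarrow> real^'n" where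
  "direction t s \<equiv> transpose (nu t) *v lam t (s - 1)
     + transpose (coupling t (s - 1)) *v (lam t (s - 1) - lam t (s - 2))"

definition linearized :: "int \<Rightarrow> real^'n \<Rightarrow> real^'m" where
  "linearized t v = nu t *v (v - xu t) + g (xu t)"

lemma extrapolation_eq_direction:
  "extrapolation (CD_stepsizes L C \<Delta> nu) nu lam t s = direction t s"
proof (cases "s = 1")
  case True
  have "(transpose ((Mt t / Mt (t - 1)) *\<^sub>R nu (t - 1))) *v w
      = (Mt t / Mt (t - 1)) *\<^sub>R (transpose (nu (t - 1)) *v w)" for w
    by (simp only: transpose_scaleR scaleR_matrix_vector_assoc)
  then show ?thesis using True
    by (simp add: extrapolation_def coupling_def CD_stepsizes_def Let_def
        del: transpose_matrix_vector)
next
  case False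
  then show ?thesis by (simp add: extrapolation_def coupling_def)
qed

lemma S_pos: "t \<in> {1..T} \<Longrightarrow> S t \<ge> 1"
  by (rule inner_pos)

lemma Mt_pos: "t \<in> {1..T} \<Longrightarrow> Mt t > 0"
  using S_pos[of t] pos(2) by (auto simp: CD_Mt_def intro!: divide_pos_pos mult_pos_pos)

text \<open>Rounding the number of inner steps up to an integer only increases the modulus \<open>Mt\<close>.\<close>

lemma spectral_norm_le_Mt:
  assumes "t \<in> {1..T}"
  shows "spectral_norm (nu t) \<le> Mt t"
proof -
  have "spectral_norm (nu t) * (\<Delta> * of_int t) \<le> of_int (S t)"
    unfolding CD_inner_def by (simp add: mult.assoc[symmetric])
  moreover have "\<Delta> * of_int t > 0" using assms pos(2) by simp
  ultimately show ?thesis by (simp add: CD_Mt_def pos_le_divide_eq)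
qed

text \<open>At \<open>s = 0\<close> the factor \<open>\<rho>\<close> converts the bound \<open>Mt (t - 1)\<close> of the previous matrix into \<open>Mt t\<close>; at \<open>t = 1\<close>
the matrix vanishes, because \<open>Mt 0 = 0\<close>.\<close>

lemma coupling_bound:
  assumes "t \<in> {1..T}" "s \<ge> 0"
  shows "norm (coupling t s *v v) \<le> Mt t * norm v"
proof -
  have base: "norm (nu t *v v) \<le> Mt t * norm v" if "t \<in> {1..T}" for t
    using norm_matrix_vector_le[of "nu t" v] spectral_norm_le_Mt[OF that]
    by (meson mult_right_mono norm_ge_zero order_trans)
  consider "s > 0" | "s = 0" "t = 1" | "s = 0" "t - 1 \<in> {1..T}"
    using assms by force
  then show ?thesis
  proof cases
    case 1
    then show ?thesis using base assms by (simp add: coupling_def)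
  next
    case 2
    then have "coupling t s = 0" by (simp add: coupling_def CD_Mt_def)
    then show ?thesis using Mt_pos[OF assms(1)] by simp
  next
    case 3
    have q: "Mt t / Mt (t - 1) \<ge> 0" using Mt_pos[OF assms(1)] Mt_pos[OF 3(2)] by simp
    have "coupling t s *v v = (Mt t / Mt (t - 1)) *\<^sub>R (nu (t - 1) *v v)"
      using 3(1) by (simp only: coupling_def if_True refl scaleR_matrix_vector_assoc)
    then have "norm (coupling t s *v v) = Mt t / Mt (t - 1) * norm (nu (t - 1) *v v)"
      by (simp only: norm_scaleR abs_of_nonneg[OF q])
    also have "\<dots> \<le> Mt t / Mt (t - 1) * (Mt (t - 1) * norm v)"
      using q base[OF 3(2)] by (intro mult_left_mono)
    also have "\<dots> = Mt t * norm v" using Mt_pos[OF 3(2)] by simp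
    finally show ?thesis .
  qed
qed

text \<open>Young's inequality; it applies because the inner stepsizes \<open>\<beta> = C Mt\<close> and \<open>\<gamma> = Mt / C\<close> satisfy
\<open>\<beta> \<gamma> = Mt\<^sup>2\<close>.\<close>

lemma coupling_cross_bound:
  assumes "t \<in> {1..T}" "s \<ge> 0"
  shows "\<bar>w \<bullet> (coupling t s *v v)\<bar>
    \<le> C * Mt t / 2 * (norm v)\<^sup>2 + Mt t / C / 2 * (norm w)\<^sup>2"
proof -
  have "\<bar>w \<bullet> (coupling t s *v v)\<bar> \<le> norm w * norm (coupling t s *v v)" by (rule Cauchy_Schwarz_ineq2)
  also have "\<dots> \<le> norm w * (Mt t * norm v)" by (intro mult_left_mono coupling_bound assms) simp
  also have "\<dots> = Mt t * (norm w * norm v)" by simp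
  also have "\<dots> \<le> Mt t * (C / 2 * (norm v)\<^sup>2 + 1 / (2 * C) * (norm w)\<^sup>2)"
  proof (rule mult_left_mono)
    have "0 \<le> (norm w - C * norm v)\<^sup>2" by simp
    then have "2 * C * (norm w * norm v) \<le> C\<^sup>2 * (norm v)\<^sup>2 + (norm w)\<^sup>2"
      by (simp add: power2_eq_square algebra_simps)
    then show "norm w * norm v \<le> C / 2 * (norm v)\<^sup>2 + 1 / (2 * C) * (norm w)\<^sup>2"
      using pos(1) by (simp add: field_simps power2_eq_square)
    show "0 \<le> Mt t" using Mt_pos[OF assms(1)] by simp
  qed
  finally show ?thesis by (simp add: algebra_simps)
qed

lemma inner_primal:
  assumes t: "t \<in> {1..T}" and s: "s \<in> {1..S t}"
  shows "y t s \<in> domu"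
    and "w \<in> domu \<Longrightarrow>
      U (y t s) + prox_model (direction t s) (2 * L / of_int t) (x (t - 1)) (C * Mt t) (y t (s - 1)) (y t s)
        + (2 * L / of_int t + C * Mt t) / 2 * (norm (w - y t s))\<^sup>2
      \<le> U w + prox_model (direction t s) (2 * L / of_int t) (x (t - 1)) (C * Mt t) (y t (s - 1)) w"
proof -
  let ?Q = "prox_model (direction t s) (2 * L / of_int t) (x (t - 1)) (C * Mt t) (y t (s - 1))"
  let ?f = "\<lambda>v. u v + ereal (?Q v)"
  have a: "2 * L / of_int t \<ge> 0" using L_nonneg t by simp
  have b: "C * Mt t > 0" using pos(1) Mt_pos[OF t] by simp
  have "y t s = arg_min
             (\<lambda>v. ereal (direction t s \<bullet> v) + u v
                  + ereal (L / (of_int t / 2) / 2 * (norm (v - x (t - 1)))\<^sup>2)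
                  + ereal (C * Mt t / 2 * (norm (v - y t (s - 1)))\<^sup>2)) (\<lambda>v. v \<in> X)"
    using run t s unfolding extrapolation_eq_direction[symmetric]
    by (simp add: ufcm_run_def CD_stepsizes_def Let_def)
  moreover have "ereal (direction t s \<bullet> v) + u v
                  + ereal (L / (of_int t / 2) / 2 * (norm (v - x (t - 1)))\<^sup>2)
                  + ereal (C * Mt t / 2 * (norm (v - y t (s - 1)))\<^sup>2) = ?f v" for v
    by (cases "u v") (simp_all add: prox_model_def algebra_simps)
  ultimately have y: "y t s = arg_min ?f (\<lambda>v. v \<in> X)" by (simp only:)
  obtain v where v: "v \<in> X" "\<And>w. w \<in> X \<Longrightarrow> ?f v \<le> ?f w"
    using prox_ex_minimizer[OF u a b] by blast
  have yX: "y t s \<in> X"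
    by (subst y) (rule arg_min_attained(1)[where f="?f", OF v])
  have least: "?f (y t s) \<le> ?f w" if "w \<in> X" for w
    using arg_min_attained(2)[where f="?f", OF v that] by (simp only: y[symmetric])
  show "y t s \<in> domu" by (rule prox_three_point(1)[OF u yX least])
  show "w \<in> domu \<Longrightarrow> U (y t s) + ?Q (y t s)
        + (2 * L / of_int t + C * Mt t) / 2 * (norm (w - y t s))\<^sup>2 \<le> U w + ?Q w"
    by (rule prox_three_point(2)[OF u yX least])
qed

lemma inner_dual:
  assumes t: "t \<in> {1..T}" and s: "s \<in> {1..S t}"
  shows "lam t s \<in> Lambda_dom h"
    and "l \<in> Lambda_dom h \<Longrightarrow>
      H (lam t s) + prox_model (- linearized t (y t s)) 0 0 (Mt t / C) (lam t (s - 1)) (lam t s)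
        + (0 + Mt t / C) / 2 * (norm (l - lam t s))\<^sup>2
      \<le> H l + prox_model (- linearized t (y t s)) 0 0 (Mt t / C) (lam t (s - 1)) l"
proof -
  let ?Q = "prox_model (- linearized t (y t s)) 0 0 (Mt t / C) (lam t (s - 1))"
  let ?h = "conjugate_on UNIV h"
  let ?f = "\<lambda>l. ?h l + ereal (?Q l)"
  let ?F = "\<lambda>l. ereal (l \<bullet> linearized t (y t s)) - ?h l
                  - ereal (Mt t / C / 2 * (norm (l - lam t (s - 1)))\<^sup>2)"
  have b: "Mt t / C > 0" using pos(1) Mt_pos[OF t] by simp
  have h': "closed_convex_on (Lambda_dom h) ?h" "proper_on (Lambda_dom h) ?h"
    using closed_convex_conjugate[OF h(2)] proper_conjugate[OF h(2) ls_Lambda] by simp_all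
  have l: "lam t s = arg_max ?F (\<lambda>l. l \<in> Lambda_dom h)"
    using run t s by (simp add: ufcm_run_def CD_stepsizes_def Let_def linearized_def)
  have F: "?F l = - ?f l" for l
    using conjugate_not_MInf[OF h(2), of l]
    by (cases "?h l") (simp_all add: prox_model_def inner_commute)
  obtain v where v: "v \<in> Lambda_dom h" "\<And>w. w \<in> Lambda_dom h \<Longrightarrow> ?f v \<le> ?f w"
    using prox_ex_minimizer[OF h' order_refl b] by blast
  have max: "?F w \<le> ?F v" if "w \<in> Lambda_dom h" for w
    using v(2)[OF that] by (simp only: F ereal_minus_le_minus)
  have lX: "lam t s \<in> Lambda_dom h"
    unfolding l by (rule arg_max_attained(1)[where f="?F", OF v(1) max])
  have least: "?f (lam t s) \<le> ?f w" if "w \<in> Lambda_dom h" for w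
  proof -
    have "?F w \<le> ?F (arg_max ?F (\<lambda>l. l \<in> Lambda_dom h))"
      by (rule arg_max_attained(2)[where f="?F", OF v(1) max that])
    then have "?F w \<le> ?F (lam t s)" by (simp only: l[symmetric])
    then show ?thesis by (simp only: F ereal_minus_le_minus)
  qed
  show "lam t s \<in> Lambda_dom h" by (rule lX)
  show "l \<in> Lambda_dom h \<Longrightarrow> H (lam t s) + ?Q (lam t s)
        + (0 + Mt t / C) / 2 * (norm (l - lam t s))\<^sup>2 \<le> H l + ?Q l"
    using prox_three_point(2)[OF h' lX least] by (simp only: effective_domain_conjugate)
qed

section \<open>Averages of the outer iterates\<close>

lemma x_dom: "t \<in> {1..T} \<Longrightarrow> x t \<in> domu"
proof -
  assume t: "t \<in> {1..T}"
  have "(\<Sum>s=1..S t. (1 / of_int (S t)) *\<^sub>R y t s) \<in> domu"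
  proof (rule convex_sum)
    show "convex domu" by (rule convex_on_imp_convex[OF closed_convex_on_imp_convex_on[OF u]])
    show "(\<Sum>s=1..S t. 1 / of_int (S t)) = (1::real)" using S_pos[OF t] by simp
  qed (use S_pos[OF t] inner_primal(1)[OF t] in auto)
  then show ?thesis by (simp add: run_average[OF t] scaleR_sum_right)
qed

lemma x_X: "t \<in> {0..T} \<Longrightarrow> x t \<in> X"
proof (cases "t = 0")
  case False
  moreover assume "t \<in> {0..T}"
  ultimately show ?thesis using x_dom[of t] by (simp add: effective_domain_def)
qed (simp add: run_start x0)

text \<open>The averages are kept both unnormalized and normalized: the recursion of the linearization points is
linear in the former, while convexity arguments need the latter.\<close>

definition weighted_sum :: "int \<Rightarrow> real^'n" where
  "weighted_sum t = (\<Sum>k=1..t. of_int k *\<^sub>R x k)"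

definition ergodic :: "int \<Rightarrow> real^'n" where
  "ergodic t = (2 / (of_int t * (of_int t + 1))) *\<^sub>R weighted_sum t"

lemma ergodic_step:
  assumes "t \<ge> 1"
  shows "ergodic t = ((of_int t - 1) / (of_int t + 1)) *\<^sub>R ergodic (t - 1) + (2 / (of_int t + 1)) *\<^sub>R x t"
proof -
  have w: "weighted_sum t = weighted_sum (t - 1) + of_int t *\<^sub>R x t"
    unfolding weighted_sum_def by (rule sum_upto_last_int[OF assms])
  have c: "(of_int t - 1) / (of_int t + 1) * (2 / (of_int (t - 1) * (of_int (t - 1) + 1)))
      = (2 / (of_int t * (of_int t + 1)) :: real)" if "t \<noteq> 1"
    using averaging_weight_shift[of "of_int t"] that assms by simp
  have d: "2 / (of_int t * (of_int t + 1)) * of_int t = (2 / (of_int t + 1) :: real)"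
    using assms mult_divide_mult_cancel_left[of "of_int t" 2 "of_int t + 1 :: real"]
    by (simp add: mult.commute)
  show ?thesis
  proof (cases "t = 1")
    case True
    then show ?thesis by (simp add: ergodic_def weighted_sum_def)
  next
    case False
    show ?thesis
      by (simp only: ergodic_def w scaleR_add_right scaleR_scaleR c[OF False] d)
  qed
qed

lemma ergodic_dom: "1 \<le> t \<Longrightarrow> t \<le> T \<Longrightarrow> ergodic t \<in> domu"
proof (induction t rule: int_ge_induct)
  case base
  then show ?case using ergodic_step[of 1] x_dom[of 1] by simp
next
  case (step t)
  have cv: "convex domu" by (rule convex_on_imp_convex[OF closed_convex_on_imp_convex_on[OF u]])
  have ge: "t + 1 \<ge> 1" and n: "of_int (t + 1) \<ge> (1::real)" using step by simp_all
  show ?case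
    unfolding ergodic_step[OF ge]
    by (rule convexD[OF cv _ _ averaging_weights[OF n]]) (use step x_dom[of "t + 1"] in auto)
qed

text \<open>Multiplying the update by \<open>t (t + 1)\<close> clears the denominators and makes both sides telescope.\<close>

lemma linearization_point_step:
  assumes t: "t \<in> {1..T}"
  shows "(of_int t * (of_int t + 1)) *\<^sub>R xu t = (of_int t * (of_int t - 1)) *\<^sub>R xu (t - 1)
    + (2 * of_int t) *\<^sub>R x (t - 1) + (2 * (of_int t - 1)) *\<^sub>R (x (t - 1) - x (t - 2))"
proof -
  have t0: "of_int t \<ge> (1::real)" using t by simp
  have "(1 + (of_int t - 1) / 2) *\<^sub>R xu t = ((of_int t - 1) / 2) *\<^sub>R xu (t - 1) + xt t"
  proof -
    have "a *\<^sub>R ((1 / a) *\<^sub>R v) = v" if "a > 0" for a and v :: "real^'n" using that by simp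
    moreover have "0 < 1 + (n - 1) / 2" if "n \<ge> 1" for n :: real
      using that by (simp add: field_simps)
    ultimately show ?thesis unfolding run_linearization_point[OF t] using t0 by blast
  qed
  then have "(2 * of_int t) *\<^sub>R ((1 + (of_int t - 1) / 2) *\<^sub>R xu t)
      = (2 * of_int t) *\<^sub>R (((of_int t - 1) / 2) *\<^sub>R xu (t - 1) + xt t)" by simp
  moreover have "2 * of_int t * (1 + (of_int t - 1) / 2) = (of_int t * (of_int t + 1) :: real)"
    "2 * of_int t * ((of_int t - 1) / 2) = (of_int t * (of_int t - 1) :: real)"
    "2 * of_int t * ((of_int t - 1) / of_int t) = (2 * (of_int t - 1) :: real)"
    using t0 by (simp_all add: field_simps)
  ultimately show ?thesis
    by (simp only: run_extrapolation[OF t] scaleR_add_right scaleR_scaleR add.assoc)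
qed

lemma linearization_point_sum:
  "1 \<le> t \<Longrightarrow> t \<le> T \<Longrightarrow>
    (of_int t * (of_int t + 1)) *\<^sub>R xu t = 2 *\<^sub>R weighted_sum (t - 1) + (2 * of_int t) *\<^sub>R x (t - 1)"
proof (induction t rule: int_ge_induct)
  case base
  then show ?case using linearization_point_step[of 1] by (simp add: weighted_sum_def)
next
  case (step t)
  have w: "weighted_sum t = weighted_sum (t - 1) + of_int t *\<^sub>R x t"
    unfolding weighted_sum_def by (rule sum_upto_last_int[OF step(1)])
  have "(of_int (t + 1) * (of_int (t + 1) + 1)) *\<^sub>R xu (t + 1)
      = (of_int t * (of_int t + 1)) *\<^sub>R xu t + (2 * of_int (t + 1)) *\<^sub>R x t + (2 * of_int t) *\<^sub>R (x t - x (t - 1))"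
    using linearization_point_step[of "t + 1"] step by (simp add: mult.commute)
  also have "\<dots> = 2 *\<^sub>R weighted_sum (t - 1) + (2 * of_int t) *\<^sub>R x (t - 1)
      + (2 * of_int (t + 1)) *\<^sub>R x t + (2 * of_int t) *\<^sub>R (x t - x (t - 1))"
    using step by simp
  also have "\<dots> = 2 *\<^sub>R weighted_sum t + (2 * of_int (t + 1)) *\<^sub>R x t"
    unfolding w by (simp add: algebra_simps)
  finally show ?case by simp
qed

text \<open>The extrapolation puts the linearization point where Nesterov's method puts it: between the
previous average and the latest iterate, with the weights by which the average will be updated. Replacing \<open>x (t - 1)\<close> by
\<open>x t\<close> therefore gives the next average.\<close>

lemma linearization_point_ergodic:
  assumes t: "t \<in> {1..T}"
  shows "xu t = ((of_int t - 1) / (of_int t + 1)) *\<^sub>R ergodic (t - 1) + (2 / (of_int t + 1)) *\<^sub>R x (t - 1)"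
proof -
  have n: "of_int t * (of_int t + 1) \<noteq> (0::real)" using t by (simp add: add_eq_0_iff)
  have "xu t = (1 / (of_int t * (of_int t + 1))) *\<^sub>R ((of_int t * (of_int t + 1)) *\<^sub>R xu t)"
    using n by simp
  also have "\<dots> = (2 / (of_int t * (of_int t + 1))) *\<^sub>R weighted_sum (t - 1)
      + (2 * of_int t / (of_int t * (of_int t + 1))) *\<^sub>R x (t - 1)"
    using linearization_point_sum[of t] t by (simp add: scaleR_add_right)
  also have "2 * of_int t / (of_int t * (of_int t + 1)) = (2 / (of_int t + 1) :: real)"
    using t mult_divide_mult_cancel_left[of "of_int t" 2 "of_int t + 1 :: real"]
    by (simp add: mult.commute)
  also have "(2 / (of_int t * (of_int t + 1))) *\<^sub>R weighted_sum (t - 1)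
      = ((of_int t - 1) / (of_int t + 1)) *\<^sub>R ergodic (t - 1)"
  proof (cases "t = 1")
    case False
    then have "(of_int t - 1) / (of_int t + 1) * (2 / (of_int (t - 1) * (of_int (t - 1) + 1)))
        = (2 / (of_int t * (of_int t + 1)) :: real)"
      using averaging_weight_shift[of "of_int t"] t by simp
    then show ?thesis by (simp only: ergodic_def scaleR_scaleR)
  qed (simp add: weighted_sum_def)
  finally show ?thesis .
qed

text \<open>Although the extrapolated points themselves may leave \<open>X\<close>, the linearization points are
convex combinations of earlier iterates. This is used for \<open>X\<close> and for a ball around \<open>xs\<close>.\<close>

lemma linearization_point_in:
  assumes t: "t \<in> {1..T}" and K: "convex K" and mem: "\<And>s. s \<in> {0..t - 1} \<Longrightarrow> x s \<in> K"
  shows "xu t \<in> K"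
proof (cases "t = 1")
  case True
  then show ?thesis using linearization_point_ergodic[OF t] mem[of 0] by simp
next
  case False
  have erg: "1 \<le> s \<Longrightarrow> s \<le> t - 1 \<Longrightarrow> ergodic s \<in> K" for s
  proof (induction s rule: int_ge_induct)
    case base
    then show ?case using ergodic_step[of 1] mem[of 1] by simp
  next
    case (step s)
    have ge: "s + 1 \<ge> 1" and n: "of_int (s + 1) \<ge> (1::real)" using step by simp_all
    show ?case
      unfolding ergodic_step[OF ge]
      by (rule convexD[OF K _ _ averaging_weights[OF n]]) (use step mem[of "s + 1"] in auto)
  qed
  have t1: "t - 1 \<ge> 1" using False t by simp
  show ?thesis
    unfolding linearization_point_ergodic[OF t]
    by (rule convexD[OF K erg[OF t1 order_refl] mem averaging_weights]) (use t in auto)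
qed

lemma linearization_point_X: "t \<in> {1..T} \<Longrightarrow> xu t \<in> X"
  by (rule linearization_point_in[OF _ X]) (auto intro: x_X)

section \<open>One inner loop\<close>

text \<open>The step potential at the inner iterate \<open>s\<close>, with comparison point \<open>(xs, l)\<close>. At \<open>s = 0\<close> it describes the state
inherited from the previous phase.\<close>

definition potential :: "real^'m \<Rightarrow> int \<Rightarrow> int \<Rightarrow> real" where
  "potential l t s = step_potential xs l (C * Mt t) (Mt t / C) (coupling t s)
     (lam t s) (lam t (s - 1)) (y t s)"

definition linearized_gap :: "real^'m \<Rightarrow> int \<Rightarrow> real^'n \<Rightarrow> real" where
  "linearized_gap l t v = l \<bullet> linearized t v - H l + U v - saddle_value"

text \<open>The linearized gap together with the outer proximal terms \<open>\<eta> / 2\<close>: all that Jensen's inequality has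
to move from the inner iterates to their mean.\<close>

definition anchored_gap :: "real^'m \<Rightarrow> int \<Rightarrow> real^'n \<Rightarrow> real" where
  "anchored_gap l t v = linearized_gap l t v
     + (2 * L / of_int t) / 2 * ((norm (v - x (t - 1)))\<^sup>2 + (norm (v - xs))\<^sup>2 - (norm (xs - x (t - 1)))\<^sup>2)"

lemma linearized_eq: "t \<in> {1..T} \<Longrightarrow> linearized t v = G (xu t) *v (v - xu t) + g (xu t)"
  by (simp add: linearized_def run_gradient)

text \<open>The value of the linearized Lagrangian at \<open>(xs, lam t s)\<close> that \<open>primal_dual_step\<close> subtracts is at
most the saddle value, since the linearization lies below \<open>g\<close>. Applying this to each dual iterate separately leaves a
bound that involves the primal iterates and the fixed \<open>l\<close> only.\<close>

lemma inner_step: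
  assumes t: "t \<in> {1..T}" and s: "s \<in> {1..S t}" and l: "l \<in> Lambda_dom h"
  shows "anchored_gap l t (y t s) \<le> potential l t s - potential l t (s - 1)"
proof -
  have lam: "lam t s \<in> Lambda_dom h" by (rule inner_dual(1)[OF t s])
  have cs: "coupling t s = nu t" using s by (simp add: coupling_def)
  have "l \<bullet> (nu t *v (y t s - xu t) + g (xu t)) - H l + U (y t s)
      - (lam t s \<bullet> (nu t *v (xs - xu t) + g (xu t)) - H (lam t s) + U xs)
      + (2 * L / of_int t) / 2 * ((norm (y t s - x (t - 1)))\<^sup>2 + (norm (xs - y t s))\<^sup>2 - (norm (xs - x (t - 1)))\<^sup>2)
    \<le> step_potential xs l (C * Mt t) (Mt t / C) (nu t) (lam t s) (lam t (s - 1)) (y t s)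
      - step_potential xs l (C * Mt t) (Mt t / C) (coupling t (s - 1)) (lam t (s - 1)) (lam t (s - 2)) (y t (s - 1))"
    by (rule primal_dual_step[OF inner_primal(2)[OF t s xs_dom]
          inner_dual(2)[OF t s l, unfolded linearized_def] coupling_cross_bound[OF t]]) (use s in simp)
  moreover have "lam t s \<bullet> linearized t xs - H (lam t s) + U xs \<le> saddle_value"
    using linearization_le[OF lam linearization_point_X[OF t] xs_X] saddle_dual[OF lam]
    unfolding linearized_eq[OF t] by simp
  ultimately show ?thesis
    unfolding anchored_gap_def linearized_gap_def potential_def cs linearized_def[symmetric]
    by (simp add: norm_minus_commute)
qed

lemma phase_sum:
  assumes t: "t \<in> {1..T}" and l: "l \<in> Lambda_dom h"
  shows "(\<Sum>s=1..S t. anchored_gap l t (y t s)) \<le> potential l t (S t) - potential l t 0"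
proof -
  have "0 \<le> k \<Longrightarrow> k \<le> S t \<Longrightarrow>
      (\<Sum>s=1..k. anchored_gap l t (y t s)) \<le> potential l t k - potential l t 0" for k
  proof (induction k rule: int_ge_induct)
    case (step k)
    then show ?case
      using sum_upto_last_int[of "k + 1" "\<lambda>s. anchored_gap l t (y t s)"] inner_step[OF t _ l, of "k + 1"]
      by simp
  qed simp
  then show ?thesis using S_pos[OF t] by simp
qed

lemma anchored_gap_convex:
  assumes t: "t \<in> {1..T}"
  shows "convex_on domu (anchored_gap l t)"
proof (rule convex_onI)
  have cv: "convex_on domu U" by (rule closed_convex_on_imp_convex_on[OF u])
  then show "convex domu" by (rule convex_on_imp_convex)
  fix s :: real and v w assume s: "0 < s" "s < 1" and vw: "v \<in> domu" "w \<in> domu"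
  let ?z = "(1 - s) *\<^sub>R v + s *\<^sub>R w"
  have U: "U ?z \<le> (1 - s) * U v + s * U w" using convex_onD[OF cv, of s v w] s vw by simp
  have lin: "l \<bullet> linearized t ?z = (1 - s) * (l \<bullet> linearized t v) + s * (l \<bullet> linearized t w)"
  proof -
    have "?z - xu t = (1 - s) *\<^sub>R (v - xu t) + s *\<^sub>R (w - xu t)" by (simp add: algebra_simps)
    then show ?thesis
      by (simp only: linearized_def matrix_vector_right_distrib matrix_vector_mult_scaleR)
        (simp add: inner_simps algebra_simps)
  qed
  have n: "(norm (?z - p))\<^sup>2 \<le> (1 - s) * (norm (v - p))\<^sup>2 + s * (norm (w - p))\<^sup>2" for p
    using norm_sq_convex_combination[of "1 - s" s v w p] s by simp
  have "(2 * L / of_int t) / 2 * ((norm (?z - x (t - 1)))\<^sup>2 + (norm (?z - xs))\<^sup>2 - (norm (xs - x (t - 1)))\<^sup>2)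
      \<le> (2 * L / of_int t) / 2 * ((1 - s) * (norm (v - x (t - 1)))\<^sup>2 + s * (norm (w - x (t - 1)))\<^sup>2
        + ((1 - s) * (norm (v - xs))\<^sup>2 + s * (norm (w - xs))\<^sup>2) - (norm (xs - x (t - 1)))\<^sup>2)"
    using L_nonneg t by (intro mult_left_mono add_mono diff_mono n) auto
  also have "\<dots> = (1 - s) * ((2 * L / of_int t) / 2 * ((norm (v - x (t - 1)))\<^sup>2 + (norm (v - xs))\<^sup>2 - (norm (xs - x (t - 1)))\<^sup>2))
      + s * ((2 * L / of_int t) / 2 * ((norm (w - x (t - 1)))\<^sup>2 + (norm (w - xs))\<^sup>2 - (norm (xs - x (t - 1)))\<^sup>2))"
  proof -
    have "c * ((1 - s) * a + s * b + ((1 - s) * a' + s * b') - d)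
      = (1 - s) * (c * (a + a' - d)) + s * (c * (b + b' - d))" for c a b a' b' d :: real
      by (simp add: algebra_simps)
    then show ?thesis .
  qed
  finally show "anchored_gap l t ?z \<le> (1 - s) * anchored_gap l t v + s * anchored_gap l t w"
    using U lin unfolding anchored_gap_def linearized_gap_def by (simp add: algebra_simps)
qed

text \<open>The potential at the end of phase \<open>t\<close>, scaled by \<open>t / S t = 1 / (\<Delta> * Mt t)\<close>. After this scaling the coefficients of the
squared distances are \<open>C / (2 * \<Delta>)\<close> and \<open>1 / (2 * C * \<Delta>)\<close> in every phase. The value at 0 is the scaled potential
at the start.\<close>

definition phase_potential :: "real^'m \<Rightarrow> int \<Rightarrow> real" where
  "phase_potential l t =
     (if t = 0 then - (C / (2 * \<Delta>)) * (norm (xs - x0))\<^sup>2 - 1 / (2 * C * \<Delta>) * (norm (l - l0))\<^sup>2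
      else potential l t (S t) / (\<Delta> * Mt t))"

text \<open>Consecutive phases fit together: after scaling, the coupling term carries the factor
\<open>\<rho> / Mt t = 1 / Mt (t - 1)\<close>. At the first phase the two initial dual iterates coincide, so only the distances remain.\<close>

lemma phase_potential_start:
  assumes t: "t \<in> {1..T}"
  shows "potential l t 0 / (\<Delta> * Mt t) = phase_potential l (t - 1)"
proof -
  have m: "Mt t > 0" "\<Delta> > 0" "C > 0" using Mt_pos[OF t] pos by auto
  show ?thesis
  proof (cases "t = 1")
    case True
    then show ?thesis using m
      by (simp add: phase_potential_def potential_def step_potential_def run_start field_simps)
  next
    case False
    then have t1: "t - 1 \<in> {1..T}" using t by simp
    have m1: "Mt (t - 1) > 0" by (rule Mt_pos[OF t1])
    have re: "lam t 0 = lam (t - 1) (S (t - 1))" "lam t (-1) = lam (t - 1) (S (t - 1) - 1)"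
      "y t 0 = y (t - 1) (S (t - 1))"
      using run_restart[OF t1] by simp_all
    have cp: "coupling t 0 = (Mt t / Mt (t - 1)) *\<^sub>R nu (t - 1)" "coupling (t - 1) (S (t - 1)) = nu (t - 1)"
      using S_pos[OF t1] by (simp_all add: coupling_def)
    have "potential l t 0 = Mt t / Mt (t - 1) * potential l (t - 1) (S (t - 1))"
      unfolding potential_def step_potential_def cp using m1
      by (simp add: re scaleR_matrix_vector_assoc[symmetric] field_simps)
    then show ?thesis using False m m1 by (simp add: phase_potential_def)
  qed
qed

text \<open>The coupling term of the last step is absorbed by the squares, again by Young's inequality.\<close>

lemma phase_potential_nonpos:
  assumes t: "t \<in> {1..T}"
  shows "phase_potential l t \<le> 0"
proof -
  have m: "Mt t > 0" "\<Delta> > 0" "C > 0" using Mt_pos[OF t] pos by auto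
  have "(lam t (S t) - lam t (S t - 1)) \<bullet> (coupling t (S t) *v (y t (S t) - xs))
    \<le> C * Mt t / 2 * (norm (y t (S t) - xs))\<^sup>2 + Mt t / C / 2 * (norm (lam t (S t) - lam t (S t - 1)))\<^sup>2"
    using coupling_cross_bound[OF t, of "S t" "lam t (S t) - lam t (S t - 1)" "y t (S t) - xs"] S_pos[OF t]
    by linarith
  moreover have "0 \<le> Mt t / C / 2 * (norm (l - lam t (S t)))\<^sup>2" using m by simp
  ultimately have "potential l t (S t) \<le> 0"
    unfolding potential_def step_potential_def norm_minus_commute[of xs] by linarith
  then show ?thesis using m t by (simp add: phase_potential_def divide_nonpos_pos)
qed

text \<open>Jensen's inequality for the mean \<open>x t\<close>. The scaling \<open>t / S t\<close> turns the outer stepsize \<open>\<eta> = 2 L / t\<close> into the constant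
\<open>L\<close>, so the distances to \<open>xs\<close> telescope.\<close>

lemma outer_step:
  assumes t: "t \<in> {1..T}" and l: "l \<in> Lambda_dom h"
  shows "of_int t * linearized_gap l t (x t)
      + L * ((norm (x t - x (t - 1)))\<^sup>2 + (norm (xs - x t))\<^sup>2 - (norm (xs - x (t - 1)))\<^sup>2)
    \<le> phase_potential l t - phase_potential l (t - 1)"
proof -
  have t0: "of_int t > (0::real)" "t \<noteq> 0" using t by auto
  have S0: "of_int (S t) > (0::real)" using S_pos[OF t] by simp
  have "anchored_gap l t (\<Sum>s=1..S t. (1 / of_int (S t)) *\<^sub>R y t s)
      \<le> (\<Sum>s=1..S t. 1 / of_int (S t) * anchored_gap l t (y t s))"
    by (rule convex_on_sum[OF _ _ anchored_gap_convex[OF t]])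
      (use S_pos[OF t] inner_primal(1)[OF t] in auto)
  then have "anchored_gap l t (x t) \<le> (\<Sum>s=1..S t. anchored_gap l t (y t s)) / of_int (S t)"
    by (simp add: run_average[OF t] scaleR_sum_right sum_divide_distrib)
  also have "\<dots> \<le> (potential l t (S t) - potential l t 0) / of_int (S t)"
    using phase_sum[OF t l] S0 by (intro divide_right_mono) auto
  finally have "of_int t * anchored_gap l t (x t)
      \<le> of_int t * ((potential l t (S t) - potential l t 0) / of_int (S t))"
    using t0 by (intro mult_left_mono) auto
  also have "\<dots> = potential l t (S t) / (\<Delta> * Mt t) - potential l t 0 / (\<Delta> * Mt t)"
    using t0 pos(2) S0 by (simp add: CD_Mt_def field_simps)
  also have "\<dots> = phase_potential l t - phase_potential l (t - 1)"
    unfolding phase_potential_start[OF t] using t0 by (simp add: phase_potential_def)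
  also have "of_int t * anchored_gap l t (x t) = of_int t * linearized_gap l t (x t)
      + L * ((norm (x t - x (t - 1)))\<^sup>2 + (norm (xs - x t))\<^sup>2 - (norm (xs - x (t - 1)))\<^sup>2)"
    unfolding anchored_gap_def norm_minus_commute[of xs "x t"] using t0 by (simp add: field_simps)
  finally show ?thesis .
qed

section \<open>Acceleration of the outer loop\<close>

text \<open>The Lagrangian at \<open>(v, l)\<close>, with the matrix variable already maximized out, relative to the saddle
value. It is nonnegative at \<open>l = ls\<close>.\<close>

definition dual_gap :: "real^'m \<Rightarrow> real^'n \<Rightarrow> real" where
  "dual_gap l v = l \<bullet> g v - H l + U v - saddle_value"

text \<open>The average and the linearization point differ by \<open>2 / (t + 1) * (x t - x (t - 1))\<close>, so smoothness at the average
costs \<open>L / 2 * 4 / (t + 1)\<^sup>2\<close> times the squared outer step, and the weight \<open>t * (t + 1) / 2\<close> leaves at most \<open>L\<close>. The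
linearization is split along the convex combination: the old average contributes a lower bound of its gap, the new
iterate its linearized gap.\<close>

lemma accelerated_step:
  assumes t: "t \<in> {1..T}" and l: "l \<in> Lambda_dom h" "norm (l - ls) \<le> r"
  shows "of_int t * (of_int t + 1) / 2 * dual_gap l (ergodic t)
    \<le> of_int t * (of_int t - 1) / 2 * dual_gap l (ergodic (t - 1))
      + of_int t * linearized_gap l t (x t) + L * (norm (x t - x (t - 1)))\<^sup>2"
proof -
  define a b :: real where "a = (of_int t - 1) / (of_int t + 1)" and "b = 2 / (of_int t + 1)"
  have t1: "of_int t \<ge> (1::real)" using t by simp
  have ab: "a \<ge> 0" "b \<ge> 0" "a + b = 1" unfolding a_def b_def using averaging_weights[OF t1] by simp_all
  let ?e = "ergodic (t - 1)"
  have e: "ergodic t = a *\<^sub>R ?e + b *\<^sub>R x t" using ergodic_step[of t] t by (simp add: a_def b_def)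
  have eX: "ergodic t \<in> X" using ergodic_dom[of t] t by (simp add: effective_domain_def)
  have diff: "ergodic t - xu t = b *\<^sub>R (x t - x (t - 1))"
    unfolding e linearization_point_ergodic[OF t] a_def[symmetric] b_def[symmetric]
    by (simp add: algebra_simps)
  have smooth: "l \<bullet> g (ergodic t) \<le> l \<bullet> linearized t (ergodic t) + L / 2 * (b\<^sup>2 * (norm (x t - x (t - 1)))\<^sup>2)"
  proof -
    have "l \<bullet> g (ergodic t) \<le> l \<bullet> linearized t (ergodic t) + L / 2 * (norm (ergodic t - xu t))\<^sup>2"
      unfolding linearized_eq[OF t] by (rule smooth_upper_bound[OF l linearization_point_X[OF t] eX])
    then show ?thesis by (simp add: diff power_mult_distrib)
  qed
  have lin: "l \<bullet> linearized t (ergodic t) = a * (l \<bullet> linearized t ?e) + b * (l \<bullet> linearized t (x t))"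
  proof -
    have d: "ergodic t - xu t = a *\<^sub>R (?e - xu t) + b *\<^sub>R (x t - xu t)"
      unfolding e using ab(3) by (simp add: algebra_simps flip: scaleR_add_left)
    have c: "a *\<^sub>R g (xu t) + b *\<^sub>R g (xu t) = g (xu t)"
      using ab(3) by (simp flip: scaleR_add_left)
    have "linearized t (ergodic t) = nu t *v (a *\<^sub>R (?e - xu t) + b *\<^sub>R (x t - xu t))
        + (a *\<^sub>R g (xu t) + b *\<^sub>R g (xu t))"
      by (simp only: linearized_def d c)
    also have "\<dots> = a *\<^sub>R linearized t ?e + b *\<^sub>R linearized t (x t)"
      by (simp only: linearized_def matrix_vector_right_distrib matrix_vector_mult_scaleR
          scaleR_add_right) simp
    finally have "linearized t (ergodic t) = a *\<^sub>R linearized t ?e + b *\<^sub>R linearized t (x t)" .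
    then show ?thesis by (simp add: inner_simps)
  qed
  \<comment> \<open>At \<open>t = 1\<close> the coefficient \<open>a\<close> vanishes; it multiplies \<open>ergodic 0\<close>, which division by zero makes the zero
    vector, possibly outside the domain of \<open>u\<close>.\<close>
  have comb: "a * (l \<bullet> linearized t ?e) + U (ergodic t) \<le> a * (l \<bullet> g ?e) + (a * U ?e + b * U (x t))"
  proof (cases "t = 1")
    case True
    then show ?thesis unfolding e by (simp add: a_def b_def)
  next
    case False
    then have ed: "?e \<in> domu" using ergodic_dom[of "t - 1"] t by simp
    have "U (a *\<^sub>R ?e + b *\<^sub>R x t) \<le> a * U ?e + b * U (x t)"
      using closed_convex_on_imp_convex_on[OF u] ed x_dom[OF t] ab unfolding convex_on_def by blast
    moreover have "l \<bullet> linearized t ?e \<le> l \<bullet> g ?e"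
      unfolding linearized_eq[OF t]
      by (rule linearization_le[OF l(1) linearization_point_X[OF t]])
        (use ed in \<open>simp add: effective_domain_def\<close>)
    ultimately show ?thesis unfolding e using ab(1) by (simp add: add_mono mult_left_mono)
  qed
  have split: "q = a * q + b * q" for q using ab(3) by (simp flip: distrib_right)
  have "dual_gap l (ergodic t) \<le> a * dual_gap l ?e + b * linearized_gap l t (x t)
      + L / 2 * (b\<^sup>2 * (norm (x t - x (t - 1)))\<^sup>2)"
    using smooth lin comb split[of "H l"] split[of saddle_value]
    unfolding dual_gap_def linearized_gap_def by (simp add: algebra_simps)
  then have "of_int t * (of_int t + 1) / 2 * dual_gap l (ergodic t)
      \<le> of_int t * (of_int t + 1) / 2 * (a * dual_gap l ?e + b * linearized_gap l t (x t)
      + L / 2 * (b\<^sup>2 * (norm (x t - x (t - 1)))\<^sup>2))"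
    using t1 by (intro mult_left_mono) auto
  also have "\<dots> = of_int t * (of_int t - 1) / 2 * dual_gap l ?e + of_int t * linearized_gap l t (x t)
      + of_int t / (of_int t + 1) * (L * (norm (x t - x (t - 1)))\<^sup>2)"
  proof -
    have w: "k * m / 2 * (p / m) = k * p / 2" "k * m / 2 * (2 / m) = k"
      "k * m / 2 * (L / 2 * ((2 / m)\<^sup>2 * n)) = k / m * (L * n)" if "m > 0" for k m n p :: real
      using that by (simp_all add: field_simps power2_eq_square)
    have eqs: "of_int t * (of_int t + 1) / 2 * a = of_int t * (of_int t - 1) / 2"
      "of_int t * (of_int t + 1) / 2 * b = of_int t"
      "of_int t * (of_int t + 1) / 2 * (L / 2 * (b\<^sup>2 * n)) = of_int t / (of_int t + 1) * (L * n)" for n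
      unfolding a_def b_def by (rule w; use t1 in linarith)+
    have "k * (a * p + b * q + s) = k * a * p + k * b * q + k * s" for k p q s
      by (simp add: algebra_simps)
    then show ?thesis by (simp only: eqs)
  qed
  also have "of_int t / (of_int t + 1) * (L * (norm (x t - x (t - 1)))\<^sup>2) \<le> 1 * (L * (norm (x t - x (t - 1)))\<^sup>2)"
    using t1 L_nonneg by (intro mult_right_mono) auto
  finally show ?thesis by simp
qed

text \<open>In the sum of \<open>accelerated_step\<close> and \<open>outer_step\<close> the linearized gap and the squared outer step cancel.\<close>

lemma ergodic_gap_telescoped:
  assumes l: "l \<in> Lambda_dom h" "norm (l - ls) \<le> r"
  shows "0 \<le> t \<Longrightarrow> t \<le> T \<Longrightarrow>
    of_int t * (of_int t + 1) / 2 * dual_gap l (ergodic t) + L * (norm (xs - x t))\<^sup>2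
    \<le> L * (norm (xs - x0))\<^sup>2 + phase_potential l t - phase_potential l 0"
proof (induction t rule: int_ge_induct)
  case base
  then show ?case by (simp add: run_start)
next
  case (step t)
  have t: "t + 1 \<in> {1..T}" using step by simp
  have "of_int (t + 1) * (of_int (t + 1) - 1) / 2 = (of_int t * (of_int t + 1) / 2 :: real)"
    by (simp add: mult.commute)
  then have "of_int (t + 1) * (of_int (t + 1) + 1) / 2 * dual_gap l (ergodic (t + 1))
      \<le> of_int t * (of_int t + 1) / 2 * dual_gap l (ergodic t)
        + of_int (t + 1) * linearized_gap l (t + 1) (x (t + 1)) + L * (norm (x (t + 1) - x t))\<^sup>2"
    using accelerated_step[OF t l] by (simp only: add_diff_cancel_right')
  moreover have "of_int (t + 1) * linearized_gap l (t + 1) (x (t + 1))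
      + L * (norm (x (t + 1) - x t))\<^sup>2 + L * (norm (xs - x (t + 1)))\<^sup>2 - L * (norm (xs - x t))\<^sup>2
    \<le> phase_potential l (t + 1) - phase_potential l t"
    using outer_step[OF t l(1)] by (simp only: add_diff_cancel_right' distrib_left right_diff_distrib)
  moreover have "of_int t * (of_int t + 1) / 2 * dual_gap l (ergodic t) + L * (norm (xs - x t))\<^sup>2
    \<le> L * (norm (xs - x0))\<^sup>2 + phase_potential l t - phase_potential l 0"
    using step by simp
  ultimately show ?case by linarith
qed

lemma ergodic_gap_bound:
  assumes t: "t \<in> {1..T}" and l: "l \<in> Lambda_dom h" "norm (l - ls) \<le> r"
  shows "of_int t * (of_int t + 1) / 2 * dual_gap l (ergodic t) + L * (norm (xs - x t))\<^sup>2
    \<le> (C / (2 * \<Delta>) + L) * (norm (xs - x0))\<^sup>2 + 1 / (2 * C * \<Delta>) * (norm (l - l0))\<^sup>2"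
  using ergodic_gap_telescoped[OF l, of t] phase_potential_nonpos[OF t, of l] t
  by (simp add: phase_potential_def[of l 0] algebra_simps)

text \<open>At the multiplier \<open>ls\<close> the gap is nonnegative and can be dropped. The bound is multiplied out by
\<open>2 * L\<close> so that it also makes sense for affine \<open>g\<close>, where \<open>L = 0\<close>.\<close>

lemma iterate_distance:
  assumes t: "t \<in> {0..T}"
  shows "2 * L * (norm (x t - xs))\<^sup>2
    \<le> (C / \<Delta> + 2 * L) * (norm (x0 - xs))\<^sup>2 + 1 / (C * \<Delta>) * (norm (l0 - ls))\<^sup>2"
proof (cases "t = 0")
  case True
  have "0 \<le> C / \<Delta> * (norm (x0 - xs))\<^sup>2" "0 \<le> 1 / (C * \<Delta>) * (norm (l0 - ls))\<^sup>2" using pos by simp_all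
  then show ?thesis using True by (simp add: run_start algebra_simps)
next
  case False
  then have t1: "t \<in> {1..T}" using t by auto
  have "0 \<le> dual_gap ls (ergodic t)"
    using saddle_primal[OF ergodic_dom[of t]] t1 by (simp add: dual_gap_def)
  then have "0 \<le> of_int t * (of_int t + 1) / 2 * dual_gap ls (ergodic t)"
    using t by simp
  then have "L * (norm (xs - x t))\<^sup>2
      \<le> (C / (2 * \<Delta>) + L) * (norm (xs - x0))\<^sup>2 + 1 / (2 * C * \<Delta>) * (norm (ls - l0))\<^sup>2"
    using ergodic_gap_bound[OF t1 ls_Lambda] pos(3) by simp
  then show ?thesis by (simp add: norm_minus_commute field_simps)
qed

section \<open>The two complexities\<close>

lemma output_eq_ergodic: "xbar = ergodic T"
proof -
  have s: "(\<Sum>t=1..T. of_int t) = (of_int T * (of_int T + 1) / 2 :: real)"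
    using sum_of_int[of T] T by simp
  show ?thesis unfolding run_output ergodic_def weighted_sum_def s by simp
qed

text \<open>Let \<open>(w, m)\<close> be the pair from the exact penalty. At \<open>g xbar\<close>, the affine minorant of \<open>h\<close> that touches it at
\<open>w\<close> has the value \<open>m \<bullet> g xbar\<close> minus the conjugate at \<open>m\<close>, so the first requirement is the gap bound at \<open>m\<close>.
For the second, \<open>(m - ls) \<bullet> (g xbar - w)\<close> is at most the difference of the gaps at \<open>m\<close> and \<open>ls\<close>, and
the gap at \<open>ls\<close> is nonnegative.\<close>

lemma eps_r_optimal_output:
  assumes gap: "\<And>l. l \<in> Lambda_dom h \<Longrightarrow> norm (l - ls) \<le> r \<Longrightarrow> dual_gap l xbar \<le> e"
  shows "eps_r_optimal X u g h e r xbar"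
proof -
  have xd: "xbar \<in> domu" unfolding output_eq_ergodic using ergodic_dom[of T] T by simp
  obtain w m c where w: "h w = ereal c" "m \<in> subdifferential h w" "norm (m - ls) \<le> r"
    and norm: "r * norm (g xbar - w) \<le> (m - ls) \<bullet> (g xbar - w)"
    using exact_penalty_subgradient[OF h(1,2) ls_Lambda pos(3)] by blast
  have Hm: "conjugate_on UNIV h m = ereal (m \<bullet> w - c)" by (rule conjugate_at_subgradient[OF w(2,1)])
  then have mL: "m \<in> Lambda_dom h" by (simp add: Lambda_dom_def)
  have g1: "m \<bullet> g xbar - (m \<bullet> w - c) + U xbar - saddle_value \<le> e"
    using gap[OF mL w(3)] Hm by (simp add: dual_gap_def)
  have "h w + ereal (m \<bullet> (g xbar - w)) + u xbar - opt_value X u g h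
      \<le> h w + ereal (m \<bullet> (g xbar - w)) + u xbar - ereal saddle_value"
    by (rule ereal_minus_mono[OF order_refl saddle_value_le_opt])
  also have "\<dots> = ereal (c + m \<bullet> (g xbar - w) + U xbar - saddle_value)"
    using u_real[OF xd] w(1) by (metis ereal_minus(1) plus_ereal.simps(1))
  also have "\<dots> \<le> ereal e" using g1 by (simp add: inner_diff_right)
  finally have first: "h w + ereal (m \<bullet> (g xbar - w)) + u xbar - opt_value X u g h \<le> ereal e" .
  have "ls \<bullet> w - c \<le> H ls"
    using fenchel_young[of w UNIV ls h] conjugate_real[OF h(2) ls_Lambda] w(1)
    by (metis UNIV_I ereal_less_eq(3) ereal_minus(1))
  then have "(m - ls) \<bullet> (g xbar - w) \<le> e"
    using g1 saddle_primal[OF xd] by (simp add: inner_simps)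
  then have "r * norm (g xbar - w) \<le> e" using norm by simp
  then show ?thesis
    using first w(2) xd by (auto simp: eps_r_optimal_def effective_domain_def)
qed

text \<open>For multipliers within \<open>r\<close> of \<open>ls\<close>, \<open>(norm (l - l0))\<^sup>2 \<le> 2 * (Dl\<^sup>2 + r\<^sup>2)\<close>, and the
right-hand side of \<open>ergodic_gap_bound\<close> is at most half of the quantity \<open>R = N_grad\<^sup>2 * e\<close>.\<close>

lemma gradient_complexity:
  assumes e: "e > 0" and D: "Dx \<ge> norm (x0 - xs)" "Dl \<ge> norm (l0 - ls)"
    and N: "of_int T \<ge> N_grad L C \<Delta> Dx Dl e r"
  shows "eps_r_optimal X u g h e r xbar"
proof (rule eps_r_optimal_output)
  fix l assume l: "l \<in> Lambda_dom h" "norm (l - ls) \<le> r"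
  define R where "R = (C / \<Delta> + 2 * L) * Dx\<^sup>2 + 2 / (C * \<Delta>) * (Dl\<^sup>2 + r\<^sup>2)"
  have T0: "of_int T \<ge> (1::real)" using T by simp
  have R: "R \<le> e * (of_int T)\<^sup>2"
  proof -
    have "sqrt (R / e) \<le> of_int T" using N by (simp add: N_grad_def R_def)
    then have "R / e \<le> (of_int T)\<^sup>2" using T0 sqrt_le_D by blast
    then show ?thesis using e by (simp add: field_simps)
  qed
  have "norm (l - l0) \<le> norm (l - ls) + norm (l0 - ls)"
    using norm_triangle_ineq4[of "l - ls" "l0 - ls"] by simp
  then have "norm (l - l0) \<le> r + Dl" using l(2) D(2) by linarith
  then have "(norm (l - l0))\<^sup>2 \<le> (r + Dl)\<^sup>2" by (simp add: power_mono)
  also have "\<dots> \<le> 2 * (Dl\<^sup>2 + r\<^sup>2)"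
    using sum_squares_bound[of r Dl] by (simp add: power2_sum)
  finally have dl: "1 / (2 * C * \<Delta>) * (norm (l - l0))\<^sup>2 \<le> 1 / (2 * C * \<Delta>) * (2 * (Dl\<^sup>2 + r\<^sup>2))"
    using pos by (intro mult_left_mono) auto
  have "(norm (xs - x0))\<^sup>2 \<le> Dx\<^sup>2" using D(1) by (simp add: norm_minus_commute power_mono)
  then have dx: "(C / (2 * \<Delta>) + L) * (norm (xs - x0))\<^sup>2 \<le> (C / (2 * \<Delta>) + L) * Dx\<^sup>2"
    using pos L_nonneg by (intro mult_left_mono) auto
  have "of_int T * (of_int T + 1) / 2 * dual_gap l xbar + L * (norm (xs - x T))\<^sup>2
      \<le> (C / (2 * \<Delta>) + L) * Dx\<^sup>2 + 1 / (2 * C * \<Delta>) * (2 * (Dl\<^sup>2 + r\<^sup>2))"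
    using ergodic_gap_bound[OF _ l, of T] T dl dx by (simp add: output_eq_ergodic)
  also have "\<dots> = R / 2" using pos by (simp add: R_def field_simps)
  finally have "of_int T * (of_int T + 1) / 2 * dual_gap l xbar \<le> R / 2"
    using mult_nonneg_nonneg[OF L_nonneg zero_le_power2[of "norm (xs - x T)"]] by linarith
  also have "R / 2 \<le> of_int T * (of_int T + 1) / 2 * e"
  proof -
    have "0 \<le> e * of_int T" using e T0 by simp
    then show ?thesis using R by (simp add: power2_eq_square algebra_simps)
  qed
  finally show "dual_gap l xbar \<le> e"
    using T0 by (simp add: mult_le_cancel_left_pos)
qed

text \<open>Balls are convex, so the distance bound passes from the iterates to the linearization points. If
\<open>L = 0\<close>, division by zero shrinks the ball of the hypothesis to the point \<open>xs\<close>; this suffices because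
every \<open>Ls j\<close> is then zero and the gradient is constant on \<open>X\<close>.\<close>

lemma linearization_point_gradient_bound:
  assumes M: "\<And>v. v \<in> X \<Longrightarrow>
              (norm (v - xs))\<^sup>2 \<le> 1 / (2 * L) *
                ((C / \<Delta> + 2 * L) * (norm (x0 - xs))\<^sup>2 + 1 / (C * \<Delta>) * (norm (l0 - ls))\<^sup>2) \<Longrightarrow>
              spectral_norm (G v) \<le> M"
    and t: "t \<in> {1..T}"
  shows "spectral_norm (nu t) \<le> M"
proof (cases "L = 0")
  case True
  have "Ls j = 0" for j
  proof -
    have nn: "(ls $ i + r) * Ls i \<ge> 0" for i
      using Ls_nonneg[of i] Lambda_nonneg[OF ls_Lambda, of i] pos(3) by simp
    have "(ls $ j + r) * Ls j = 0"
      using True unfolding L_ADA_def by (subst (asm) sum_nonneg_eq_0_iff) (use nn in auto)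
    then show ?thesis using Lambda_nonneg[OF ls_Lambda, of j] pos(3) by simp
  qed
  then have "dist (G (xu t) $ j) (G xs $ j) \<le> 0" for j
    using g(2)[of j] lipschitz_onD[of 0 X "\<lambda>v. G v $ j", OF _ linearization_point_X[OF t] xs_X]
    by (simp add: smooth_on_def)
  then have "nu t = G xs" unfolding run_gradient[OF t] by (simp add: vec_eq_iff)
  then show ?thesis using M[OF xs_X] True by simp
next
  case False
  then have Lp: "L > 0" using L_nonneg by simp
  define B where "B = 1 / (2 * L) *
      ((C / \<Delta> + 2 * L) * (norm (x0 - xs))\<^sup>2 + 1 / (C * \<Delta>) * (norm (l0 - ls))\<^sup>2)"
  have B: "(norm (x s - xs))\<^sup>2 \<le> B" if "s \<in> {0..T}" for s
    using iterate_distance[OF that] Lp by (simp add: B_def field_simps)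
  have "B \<ge> 0" using B[of 0] T zero_le_power2 order_trans by (metis atLeastAtMost_iff order_refl zero_le_one)
  have "xu t \<in> cball xs (sqrt B)"
  proof (rule linearization_point_in[OF t convex_cball])
    fix s assume "s \<in> {0..t - 1}"
    then have "(norm (x s - xs))\<^sup>2 \<le> B" using B t by auto
    then show "x s \<in> cball xs (sqrt B)" by (simp add: dist_norm norm_minus_commute real_le_rsqrt)
  qed
  then have "norm (xu t - xs) \<le> sqrt B" by (simp add: dist_norm norm_minus_commute)
  then have "(norm (xu t - xs))\<^sup>2 \<le> B" using \<open>B \<ge> 0\<close> by (metis norm_ge_zero power_mono real_sqrt_pow2)
  then show ?thesis
    using M[OF linearization_point_X[OF t]] run_gradient[OF t] by (simp add: B_def)
qed

lemma proximal_complexity: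
  assumes M: "\<And>v. v \<in> X \<Longrightarrow>
              (norm (v - xs))\<^sup>2 \<le> 1 / (2 * L) *
                ((C / \<Delta> + 2 * L) * (norm (x0 - xs))\<^sup>2 + 1 / (C * \<Delta>) * (norm (l0 - ls))\<^sup>2) \<Longrightarrow>
              spectral_norm (G v) \<le> M"
    and N: "0 \<le> \<lceil>N\<rceil>" "\<lceil>N\<rceil> \<le> T"
  shows "(\<Sum>t = 1..\<lceil>N\<rceil>. S t) \<le> \<lceil>P_prox N \<Delta> M\<rceil>"
proof -
  have "spectral_norm (nu 1) \<le> M"
    by (rule linearization_point_gradient_bound[OF M]) (use T in auto)
  then have M0: "M \<ge> 0" using spectral_norm_nonneg[of "nu 1"] by simp
  let ?n = "of_int \<lceil>N\<rceil> :: real"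
  have "of_int (\<Sum>t = 1..\<lceil>N\<rceil>. S t) = (\<Sum>t = 1..\<lceil>N\<rceil>. of_int (S t) :: real)" by simp
  also have "\<dots> \<le> (\<Sum>t = 1..\<lceil>N\<rceil>. 1 + \<Delta> * M * of_int t)"
  proof (rule sum_mono)
    fix t assume "t \<in> {1..\<lceil>N\<rceil>}"
    then have t: "t \<in> {1..T}" using N by auto
    have "spectral_norm (nu t) * \<Delta> * of_int t \<le> M * \<Delta> * of_int t"
      using linearization_point_gradient_bound[OF M t] pos(2) t by (intro mult_right_mono) auto
    moreover have "of_int (S t) \<le> spectral_norm (nu t) * \<Delta> * of_int t + 1"
      unfolding CD_inner_def by (rule of_int_ceiling_le_add_one)
    ultimately show "of_int (S t) \<le> 1 + \<Delta> * M * of_int t" by (simp add: mult.commute)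
  qed
  also have "\<dots> = ?n + \<Delta> * M * (?n * (?n + 1) / 2)"
    using N(1) by (simp add: sum.distrib sum_distrib_left[symmetric] sum_of_int[OF N(1)])
  also have "\<dots> \<le> ?n + \<Delta> * M * ?n\<^sup>2"
  proof -
    have "?n * (?n + 1) / 2 \<le> ?n\<^sup>2"
    proof (cases "\<lceil>N\<rceil> = 0")
      case False
      then have "1 \<le> \<lceil>N\<rceil>" using N(1) by linarith
      then have "of_int 1 \<le> ?n" by (simp only: of_int_le_iff)
      then have "?n * 1 \<le> ?n * ?n" by (intro mult_left_mono) linarith+
      then show ?thesis by (simp add: power2_eq_square algebra_simps)
    qed simp
    then show ?thesis using pos(2) M0 by (intro add_left_mono mult_left_mono) auto
  qed
  also have "\<dots> = P_prox N \<Delta> M" by (simp add: P_prox_def mult.assoc mult.commute mult.left_commute)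
  also have "\<dots> \<le> of_int \<lceil>P_prox N \<Delta> M\<rceil>" by (rule le_of_int_ceiling)
  finally show ?thesis by (simp only: of_int_le_iff)
qed

end

theorem theorem3p4:
  fixes X :: "(real^'n) set"
    and u :: "real^'n \<Rightarrow> ereal"
    and g :: "real^'n \<Rightarrow> real^'m"
    and G :: "real^'n \<Rightarrow> real^'n^'m"
    and h :: "real^'m \<Rightarrow> ereal"
    and Ls :: "'m \<Rightarrow> real"
    and x0 xs :: "real^'n" and l0 ls :: "real^'m" and ns :: "real^'n^'m"
    and C \<Delta> eps r Dx Dl M :: real
    and T :: int
    and x xt xu :: "int \<Rightarrow> real^'n" and nu :: "int \<Rightarrow> real^'n^'m"
    and y :: "int \<Rightarrow> int \<Rightarrow> real^'n" and lam :: "int \<Rightarrow> int \<Rightarrow> real^'m"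
    and lt :: "int \<Rightarrow> real^'m"
    and xbar :: "real^'n" and lbar :: "real^'m"
  assumes X: "closed X" "convex X"
    and u: "closed_convex_on X u" "proper_on X u"
    and h: "closed_convex_on UNIV h" "proper_on UNIV h" "mono h"
    and g: "\<And>j. closed_convex_on X (\<lambda>v. ereal (g v $ j))"
           "\<And>j. locally_lipschitz_on X (\<lambda>v. g v $ j)"
           "\<And>j. smooth_on X (Ls j) (\<lambda>v. g v $ j) (\<lambda>v. G v $ j)"
    and saddle: "saddle_point X u g h xs ls ns" "ns = G xs"
    and pos: "C > 0" "\<Delta> > 0" "eps > 0" "r > 0"
    and init: "x0 \<in> X" "l0 \<in> Lambda_dom h"
    and D: "Dx > 0" "Dl > 0" "Dx \<ge> norm (x0 - xs)" "Dl \<ge> norm (l0 - ls)"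
    and M: "\<And>v. v \<in> X \<Longrightarrow>
              (norm (v - xs))\<^sup>2 \<le> 1 / (2 * L_ADA Ls ls r) *
                ((C / \<Delta> + 2 * L_ADA Ls ls r) * (norm (x0 - xs))\<^sup>2
                 + 1 / (C * \<Delta>) * (norm (l0 - ls))\<^sup>2) \<Longrightarrow>
              spectral_norm (G v) \<le> M"
    and T: "T \<ge> 1"
    and run: "ufcm_run X u g G h (CD_stepsizes (L_ADA Ls ls r) C \<Delta> nu) x0 l0 T
                x xt xu nu y lam lt xbar lbar"
    and inner_pos: "\<And>t. t \<in> {1..T} \<Longrightarrow> CD_inner \<Delta> nu t \<ge> 1"
  shows "(of_int T \<ge> N_grad (L_ADA Ls ls r) C \<Delta> Dx Dl eps r \<longrightarrow>
            eps_r_optimal X u g h eps r xbar) \<and>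
         (T \<ge> \<lceil>N_grad (L_ADA Ls ls r) C \<Delta> Dx Dl eps r\<rceil> \<longrightarrow>
         (\<Sum>t = 1..\<lceil>N_grad (L_ADA Ls ls r) C \<Delta> Dx Dl eps r\<rceil>. CD_inner \<Delta> nu t)
         \<le> \<lceil>P_prox (N_grad (L_ADA Ls ls r) C \<Delta> Dx Dl eps r) \<Delta> M\<rceil>)"
proof -
  interpret exec: ufcm_execution X u g G h Ls x0 xs l0 ls C \<Delta> r T x xt xu nu y lam lt xbar lbar
    by unfold_locales (use X u h g saddle pos init T run inner_pos in auto)
  let ?N = "N_grad (L_ADA Ls ls r) C \<Delta> Dx Dl eps r"
  have "0 \<le> ((C / \<Delta> + 2 * L_ADA Ls ls r) * Dx\<^sup>2 + 2 / (C * \<Delta>) * (Dl\<^sup>2 + r\<^sup>2)) / eps"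
    using pos exec.L_nonneg by (intro divide_nonneg_pos add_nonneg_nonneg mult_nonneg_nonneg) auto
  then have "0 \<le> ?N" unfolding N_grad_def by (rule real_sqrt_ge_zero)
  then have "0 \<le> \<lceil>?N\<rceil>" by linarith
  then show ?thesis
    using exec.gradient_complexity[OF pos(3) D(3,4)] exec.proximal_complexity[OF M, of ?N] by blast
qed

end
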